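(* Let $\Omega$ be a countable alphabet with at least two symbols, let $\mu$ be an invariant and exponentially $\psi$-mixing probability measure on $\Omega^{\mathbb N}$ with contraction ratio $\rho\in(0,1)$, and let $S\subset[0,\infty)$ be a finite union of bounded intervals. There exist $k_0\in\mathbb N$ and $C>0$ such that for every $k\ge k_0$, for every $w\in\Omega^k$, and for any $h:\{0,1,2,\dots\}\to\mathbb R$ with $|h|\le1$, $$\big|\mathbb E_\mu[h(M_k^w(S))]-P(|S|,h)\big|\le C\Big(k\rho^k+\sum_{\ell\in\pi_w}\rho^\ell\Big).$$ The constant $C$ depends on the Lebesgue measure $|S|$ and the number of intervals of the set $S$.
   Context: $\mathbb N=\{1,2,\dots\}$. $\Omega$ is a countable (finite or infinite) set; $\Omega^k$ is the set of words of length $k$, $\Omega^*$ the set of finite words, $\Omega^{\mathbb N}$ the set of one-sided infinite sequences, with the sigma-algebra generated by cylinders. Positions are numbered from $1$; $x[i,j)$ denotes the block of $x$ at positions $i,\dots,j-1$. For $w\in\Omega^k$, $\mu_k(w)=\mu(\{x: x[1,k]=w\})$. For $x\in\Omega^{\mathbb N}$, $w\in\Omega^k$, $j\in\mathbb N$: $I_j(x,w)=1$ if $x[j,j+k)=w$ and $0$ otherwise. For Borel $S\subseteq[0,\infty)$ and fixed $w\in\Omega^k$, $M_k^w(S)$ is the random variable on $(\Omega^{\mathbb N},\mu)$ given by $M_k^w(x)(S)=\sum_{j\in\mathbb N:\ j\mu_k(w)\in S}I_j(x,w)$. $\mathbb E_\mu$ is expectation with respect to $\mu$. Poisson average: $P(\lambda,h)=e^{-\lambda}\sum_{j=0}^\infty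 h(j)\lambda^j/j!$. Periods: $\pi_w$ is the set of integers $\ell$ with $1\le\ell<k$ such that $w_i=w_{i+\ell}$ for all $1\le i\le k-\ell$. Contraction ratio: $\mu$ has contraction ratio $\rho\in(0,1)$ if there is $K>0$ with $\mu_k(w)\le K\rho^k$ for all $k\in\mathbb N$, $w\in\Omega^k$. Exponentially $\psi$-mixing: for $1\le k<\ell$ let $\mathcal B_{k,\ell}$ be the sigma-algebra generated by the sets $\{x: I_k(x,w)=1\}$, $w\in\Omega^{\ell-k}$, and let $\mathcal B_{k,\infty}$ be generated by these sets with $w\in\Omega^*$ ($\mathcal B_{1,1}$ is read as the trivial sigma-algebra). $\mu$ is exponentially $\psi$-mixing if there are $\sigma\in(0,1)$ and $T>0$ such that for all $k,\ell\in\mathbb N$ with $\ell>k$ and all $A\in\mathcal B_{1,k}$, $B\in\mathcal B_{\ell,\infty}$ of non-zero measure, $\left|\frac{\mu(A\cap B)}{\mu(A)\mu(B)}-1\right|\le T\sigma^{\ell-k}$. Invariant: $\mu(\{x: I_i(x,w)=1\})=\mu(\{x: I_j(x,w)=1\})$ for all $k\in\mathbb N$, $w\in\Omega^k$, $i,j\in\mathbb N$.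
   Formalization: The bound is stated only for words w with μ_k(w) > 0; for words of measure zero it can fail, e.g. i.i.d. symbols 0,1,2 with probabilities 1/2, 1/2, 0, w = 20…0 and S = [0,1). *)

theory Defs
  imports "HOL-Probability.Probability"
begin

text \<open>
  The alphabet is a type of class \<open>countable\<close>, words are lists and one-sided sequences are
  streams. Positions are numbered from 1, so the block of \<open>x\<close> of length \<open>k\<close> starting at
  position \<open>j \<ge> 1\<close> is \<open>stake k (sdrop (j - 1) x)\<close>.
\<close>

definition occ :: "nat \<Rightarrow> 'a stream \<Rightarrow> 'a list \<Rightarrow> nat" where
  "occ j x w = (if stake (length w) (sdrop (j - 1) x) = w then 1 else 0)"

definition word_prob :: "'a stream measure \<Rightarrow> 'a list \<Rightarrow> real" where
  "word_prob \<mu> w = measure \<mu> {x. stake (length w) x = w}"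

text \<open>
  If \<open>S\<close> is bounded and \<open>word_prob \<mu> w > 0\<close>, then the index set below is finite. (A sum over an
  infinite index set would be \<open>0\<close> by convention.)
\<close>

definition scaled_count :: "'a stream measure \<Rightarrow> 'a list \<Rightarrow> real set \<Rightarrow> 'a stream \<Rightarrow> nat" where
  "scaled_count \<mu> w S x = (\<Sum>j\<in>{j. 1 \<le> j \<and> real j * word_prob \<mu> w \<in> S}. occ j x w)"

definition poisson_avg :: "real \<Rightarrow> (nat \<Rightarrow> real) \<Rightarrow> real" where
  "poisson_avg lam h = exp (- lam) * (\<Sum>j. h j * lam ^ j / fact j)"

definition periods :: "'a list \<Rightarrow> nat set" where
  "periods w = {l. 1 \<le> l \<and> l < length w \<and>
                  (\<forall>i. 1 \<le> i \<and> i \<le> length w - l \<longrightarrow> w ! (i - 1) = w ! (i + l - 1))}"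

definition has_contraction_ratio :: "'a stream measure \<Rightarrow> real \<Rightarrow> bool" where
  "has_contraction_ratio \<mu> \<rho> \<longleftrightarrow>
     0 < \<rho> \<and> \<rho> < 1 \<and>
     (\<exists>K>0. \<forall>k\<ge>1. \<forall>w. length w = k \<longrightarrow> word_prob \<mu> w \<le> K * \<rho> ^ k)"

text \<open>
  For \<open>k = l\<close> the only generator of \<open>block_algebra k l\<close> is \<open>UNIV\<close> (from the empty word), so
  \<open>block_algebra 1 1\<close> is the trivial sigma-algebra.
\<close>

definition block_algebra :: "nat \<Rightarrow> nat \<Rightarrow> 'a stream set set" where
  "block_algebra k l = sigma_sets UNIV {{x. occ k x w = 1} | w. length w = l - k}"

definition tail_algebra :: "nat \<Rightarrow> 'a stream set set" where
  "tail_algebra k = sigma_sets UNIV {{x. occ k x w = 1} | w. True}"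

definition exp_psi_mixing :: "'a stream measure \<Rightarrow> bool" where
  "exp_psi_mixing \<mu> \<longleftrightarrow>
     (\<exists>\<sigma> T. 0 < \<sigma> \<and> \<sigma> < 1 \<and> 0 < T \<and>
        (\<forall>k l. 1 \<le> k \<and> k < l \<longrightarrow>
          (\<forall>A\<in>block_algebra 1 k. \<forall>B\<in>tail_algebra l.
             measure \<mu> A \<noteq> 0 \<and> measure \<mu> B \<noteq> 0 \<longrightarrow>
             \<bar>measure \<mu> (A \<inter> B) / (measure \<mu> A * measure \<mu> B) - 1\<bar> \<le> T * \<sigma> ^ (l - k))))"

definition word_invariant :: "'a stream measure \<Rightarrow> bool" where
  "word_invariant \<mu> \<longleftrightarrow>
     (\<forall>k\<ge>1. \<forall>w. length w = k \<longrightarrow>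
        (\<forall>i\<ge>1. \<forall>j\<ge>1. measure \<mu> {x. occ i x w = 1} = measure \<mu> {x. occ j x w = 1}))"

definition union_of_bounded_intervals :: "nat \<Rightarrow> real set \<Rightarrow> bool" where
  "union_of_bounded_intervals n S \<longleftrightarrow>
     (\<exists>F. finite F \<and> card F = n \<and> (\<forall>I\<in>F. is_interval I \<and> bounded I) \<and> S = \<Union>F)"

end

theory Submission
  imports Defs
begin

text \<open>
  Chen--Stein method. Let \<open>W\<close> be the sum of the indicators \<open>X\<^sub>j\<close> of an occurrence of \<open>w\<close> at \<open>j\<close>, over the
  positions \<open>j\<close> with \<open>j * p \<in> S\<close>, where \<open>p = word_prob \<mu> w\<close>. Writing \<open>h - P(\<lambda>, h)\<close> as
  \<open>\<lambda> f (j + 1) - j f j\<close> with a bounded \<open>f\<close>, the error \<open>E h(W) - P(\<lambda>, h)\<close> becomes a sum over \<open>j\<close> of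
  \<open>E (p f (W + 1) - X\<^sub>j f W)\<close>. In each term the occurrences within distance \<open>R = (c + 1) k\<close> of \<open>j\<close>,
  where \<open>\<sigma> ^ c \<le> \<rho>\<close>, are discarded. The remaining count is almost independent of \<open>X\<^sub>j\<close>, by mixing
  across two gaps of length \<open>c k\<close>. Discarding costs \<open>O(R p\<^sup>2)\<close> plus the probability of two occurrences
  at distance \<open>l < R\<close>, which is \<open>O(\<rho> ^ min l k * p)\<close> and vanishes if \<open>l < k\<close> is not a period. Summation
  over about \<open>|S| / p\<close> positions gives the bound, and replacing \<open>\<lambda> = E W\<close> by \<open>|S|\<close> costs \<open>O(n p)\<close>.
\<close>

subsection \<open>Poisson averages and the Stein equation\<close>

lemma summable_poisson:
  fixes g :: "nat \<Rightarrow> real" and x :: real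
  assumes "\<And>j. \<bar>g j\<bar> \<le> b"
  shows "summable (\<lambda>j. g j * x ^ j / fact j)"
proof (rule summable_comparison_test')
  show "summable (\<lambda>j. b * (\<bar>x\<bar> ^ j / fact j))"
    using summable_exp_generic[of "\<bar>x\<bar>"] by (intro summable_mult) (simp add: divide_inverse mult.commute)
  show "norm (g j * x ^ j / fact j) \<le> b * (\<bar>x\<bar> ^ j / fact j)" if "j \<ge> 0" for j
    using mult_right_mono[OF assms[of j], of "\<bar>x\<bar> ^ j / fact j"]
    by (simp add: abs_mult power_abs)
qed

lemma exp_real_sums: "(\<lambda>j. x ^ j / fact j) sums exp (x :: real)"
  using exp_converges[of x] by (simp add: divide_inverse mult.commute)

text \<open>Serves an empty set of positions, where the mean is 0 and the Stein equation cannot be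
  solved by division. Since \<open>0 ^ 0 = 1\<close>, the term \<open>j = 0\<close>
  survives.\<close>

lemma poisson_avg_0: "poisson_avg 0 h = h 0"
proof -
  have "(\<Sum>j. h j * 0 ^ j / fact j) = (\<Sum>j\<in>{0}. h j * 0 ^ j / fact j)"
    by (rule suminf_finite) auto
  then show ?thesis by (simp add: poisson_avg_def)
qed

lemma abs_poisson_avg_le:
  assumes "0 \<le> x" "\<And>j. \<bar>h j\<bar> \<le> 1"
  shows "\<bar>poisson_avg x h\<bar> \<le> 1"
proof -
  have "\<bar>\<Sum>j. h j * x ^ j / fact j\<bar> \<le> (\<Sum>j. x ^ j / fact j)"
  proof -
    have "norm (\<Sum>j. h j * x ^ j / fact j) \<le> (\<Sum>j. x ^ j / fact j)"
      using assms exp_real_sums[of x]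
      by (intro norm_suminf_le) (auto simp: sums_iff abs_mult mult_left_le_one_le divide_right_mono)
    then show ?thesis by simp
  qed
  also have "\<dots> = exp x" using exp_real_sums[of x] by (simp add: sums_iff)
  finally show ?thesis
    by (simp add: poisson_avg_def abs_mult exp_minus field_simps)
qed


text \<open>Lets the mean number of occurrences be exchanged for the measure of \<open>S\<close>. As
  powers are monotone, the difference of the two series weighted by \<open>h\<close> is dominated
  termwise by the difference of two exponential series.\<close>

lemma poisson_avg_lipschitz:
  assumes "0 \<le> x" "0 \<le> y" and h: "\<And>j. \<bar>h j\<bar> \<le> 1"
  shows "\<bar>poisson_avg x h - poisson_avg y h\<bar> \<le> 2 * \<bar>x - y\<bar>"
proof -
  have *: "\<bar>poisson_avg y h - poisson_avg x h\<bar> \<le> 2 * (y - x)" if "0 \<le> x" "x \<le> y" for x y :: real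
  proof -
    define H where "H z = (\<Sum>j. h j * z ^ j / fact j)" for z :: real
    have s: "summable (\<lambda>j. h j * z ^ j / fact j)" for z :: real
      using h by (rule summable_poisson)
    have Hx: "\<bar>H x\<bar> \<le> exp x"
      using abs_poisson_avg_le[of x h] that h
      by (simp add: H_def poisson_avg_def abs_mult exp_minus field_simps)
    have "norm (\<Sum>j. h j * y ^ j / fact j - h j * x ^ j / fact j)
        \<le> (\<Sum>j. y ^ j / fact j - x ^ j / fact j)"
    proof (rule norm_suminf_le)
      show "summable (\<lambda>j. y ^ j / fact j - x ^ j / fact j)"
        using exp_real_sums[of x] exp_real_sums[of y] by (intro summable_diff) (auto simp: sums_iff)
      show "norm (h j * y ^ j / fact j - h j * x ^ j / fact j) \<le> y ^ j / fact j - x ^ j / fact j" for j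
      proof -
        have "h j * y ^ j / fact j - h j * x ^ j / fact j = h j * (y ^ j / fact j - x ^ j / fact j)"
          by (simp add: field_simps)
        moreover have "0 \<le> y ^ j / fact j - x ^ j / fact j"
          using that by (simp add: divide_right_mono power_mono)
        ultimately show ?thesis
          using h[of j] by (simp add: abs_mult mult_left_le_one_le del: diff_ge_0_iff_ge)
      qed
    qed
    also have "(\<Sum>j. h j * y ^ j / fact j - h j * x ^ j / fact j) = H y - H x"
      unfolding H_def by (rule suminf_diff[symmetric, OF s s])
    also have "(\<Sum>j. y ^ j / fact j - x ^ j / fact j) = exp y - exp x"
      using sums_diff[OF exp_real_sums[of y] exp_real_sums[of x]] by (simp add: sums_iff)
    finally have d: "\<bar>H y - H x\<bar> \<le> exp y - exp x" by simp
    \<comment> \<open>The change is split into that of the series and that of the normalising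
      factor; each part is at most \<open>1 - exp (x - y)\<close>.\<close>
    have "poisson_avg y h - poisson_avg x h = exp (-y) * (H y - H x) - (exp (-x) - exp (-y)) * H x"
      by (simp add: poisson_avg_def H_def[symmetric] algebra_simps)
    also have "\<bar>\<dots>\<bar> \<le> exp (-y) * \<bar>H y - H x\<bar> + (exp (-x) - exp (-y)) * \<bar>H x\<bar>"
      by (rule order_trans[OF abs_triangle_ineq4]) (use that in \<open>simp add: abs_mult\<close>)
    also have "\<dots> \<le> exp (-y) * (exp y - exp x) + (exp (-x) - exp (-y)) * exp x"
      using d Hx that by (intro add_mono mult_left_mono) auto
    also have "\<dots> = 2 * (1 - exp (x - y))"
      by (simp add: algebra_simps exp_diff exp_minus divide_inverse)
    also have "\<dots> \<le> 2 * (y - x)"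
      by (rule mult_left_mono) (use exp_ge_add_one_self[of "x - y"] in \<open>auto simp: algebra_simps simp del: exp_ge_add_one_self\<close>)
    finally show ?thesis .
  qed
  show ?thesis using *[of x y] *[of y x] assms by (cases "x \<le> y") auto
qed

text \<open>Read as a recursion in \<open>j\<close>, the equation has an explicit solution built
  from the partial sums of the centred function \<open>g\<close> with weights
  \<open>x ^ i / fact i\<close>. The bound is uniform in \<open>j\<close> and does not blow up as
  \<open>x\<close> tends to 0.\<close>

lemma stein_equation_solution:
  fixes x :: real
  assumes x: "0 < x" and h: "\<And>j. \<bar>h j\<bar> \<le> 1"
  obtains f :: "nat \<Rightarrow> real" where
    "\<And>j. \<bar>f j\<bar> \<le> 2 * exp x"
    "\<And>j. x * f (Suc j) - real j * f j = h j - poisson_avg x h"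
proof
  define g where "g j = h j - poisson_avg x h" for j
  \<comment> \<open>The equation at \<open>j = 0\<close> leaves \<open>f 0\<close> free; the value 0
    is chosen.\<close>
  define f where "f j = (case j of 0 \<Rightarrow> 0 | Suc j \<Rightarrow> fact j / x ^ Suc j * (\<Sum>i<Suc j. g i * x ^ i / fact i))" for j
  have g: "\<bar>g j\<bar> \<le> 2" for j
    proof -
    have "\<bar>poisson_avg x h\<bar> \<le> 1" using x h by (intro abs_poisson_avg_le) auto
    then show ?thesis unfolding g_def using h[of j] by linarith
  qed
  have sg: "summable (\<lambda>i. g i * x ^ i / fact i)" using g by (rule summable_poisson)
  \<comment> \<open>Since \<open>g\<close> has mean 0 under the Poisson law, its whole weighted
    series vanishes.\<close>
  have "(\<lambda>i. h i * x ^ i / fact i - poisson_avg x h * (x ^ i / fact i)) sums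
     ((\<Sum>i. h i * x ^ i / fact i) - exp x * poisson_avg x h)"
    unfolding mult.commute[of "exp x"]
    by (intro sums_diff sums_mult exp_real_sums summable_sums summable_poisson[OF h])
  moreover have "exp x * poisson_avg x h = (\<Sum>i. h i * x ^ i / fact i)"
    by (simp add: poisson_avg_def exp_minus)
  ultimately have "(\<lambda>i. g i * x ^ i / fact i) sums 0"
    by (simp add: g_def left_diff_distrib diff_divide_distrib)
  then have g0: "(\<Sum>i. g i * x ^ i / fact i) = 0" by (simp add: sums_iff)
  show "x * f (Suc j) - real j * f j = h j - poisson_avg x h" for j
  proof (cases j)
    case 0
    then show ?thesis using x by (simp add: f_def g_def)
  next
    case (Suc i)
    have "x * f (Suc j) = fact j / x ^ j * (\<Sum>i<Suc j. g i * x ^ i / fact i)"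
      using x by (simp add: f_def)
    also have "\<dots> = fact j / x ^ j * (\<Sum>i<j. g i * x ^ i / fact i) + g j"
      using x by (simp add: algebra_simps)
    also have "fact j / x ^ j * (\<Sum>i<j. g i * x ^ i / fact i) = real j * f j"
      using Suc by (simp add: f_def)
    finally show ?thesis by (simp add: g_def)
  qed
  show "\<bar>f j\<bar> \<le> 2 * exp x" for j
  proof (cases j)
    case 0
    then show ?thesis by (simp add: f_def)
  next
    case (Suc n)
    \<comment> \<open>As the whole series vanishes, the partial sum in \<open>f\<close> is minus the tail, whose bound has no
      negative power of \<open>x\<close>.\<close>
    have "norm (\<Sum>i. g (i + j) * x ^ (i + j) / fact (i + j)) \<le> (\<Sum>i. 2 * x ^ j / fact n * (x ^ i / fact i))"
    proof (rule norm_suminf_le)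
      show "summable (\<lambda>i. 2 * x ^ j / fact n * (x ^ i / fact i))"
        using exp_real_sums[of x] by (intro summable_mult) (auto simp: sums_iff)
      show "norm (g (i + j) * x ^ (i + j) / fact (i + j)) \<le> 2 * x ^ j / fact n * (x ^ i / fact i)" for i
      proof -
        \<comment> \<open>Binomial coefficients are at least 1. Hence the tail from
          \<open>j = Suc n\<close> on is dominated by \<open>x ^ j / fact n\<close> times a full
          exponential series.\<close>
        have "fact n * fact i \<le> (fact (n + i) :: nat)"
          by (rule dvd_imp_le[OF fact_fact_dvd_fact]) simp
        also have "\<dots> \<le> fact (i + j)" using Suc by (intro fact_mono) simp
        finally have *: "fact n * fact i \<le> (fact (i + j) :: real)"
          by (metis of_nat_fact of_nat_le_iff of_nat_mult)
        have "norm (g (i + j) * x ^ (i + j) / fact (i + j)) \<le> 2 * x ^ (i + j) / fact (i + j)"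
          using x g[of "i + j"] by (simp add: abs_mult divide_right_mono)
        also have "\<dots> \<le> 2 * x ^ (i + j) / (fact n * fact i)"
          using * x by (intro divide_left_mono) auto
        finally show ?thesis by (simp add: power_add mult_ac)
      qed
    qed
    also have "(\<Sum>i. 2 * x ^ j / fact n * (x ^ i / fact i)) = 2 * x ^ j / fact n * exp x"
      using sums_mult[OF exp_real_sums[of x], of "2 * x ^ j / fact n"] by (simp add: sums_iff)
    also have "(\<Sum>i. g (i + j) * x ^ (i + j) / fact (i + j)) = - (\<Sum>i<j. g i * x ^ i / fact i)"
      using suminf_minus_initial_segment[OF sg, of j] g0 by simp
    finally have "\<bar>\<Sum>i<j. g i * x ^ i / fact i\<bar> \<le> 2 * x ^ j / fact n * exp x" by simp
    then have "fact n / x ^ j * \<bar>\<Sum>i<j. g i * x ^ i / fact i\<bar> \<le> fact n / x ^ j * (2 * x ^ j / fact n * exp x)"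
      using x by (intro mult_left_mono) auto
    also have "\<dots> = 2 * exp x" using x by simp
    finally show ?thesis using x by (simp add: f_def Suc abs_mult del: sum.lessThan_Suc)
  qed
qed

subsection \<open>Lattice points in unions of intervals\<close>

lemma fmeasurable_lborel_bounded:
  fixes A :: "'a::euclidean_space set"
  assumes "A \<in> sets borel" "bounded A"
  shows "A \<in> fmeasurable lborel"
proof -
  obtain a b where "A \<subseteq> cbox a b" using bounded_subset_cbox_symmetric[OF assms(2)] by blast
  then show ?thesis using assms(1) by (intro fmeasurableI2[OF fmeasurable_cbox]) simp_all
qed

text \<open>Used to charge every discrepancy in the lattice point count to an end point of some
  interval. If \<open>x\<close> lies in \<open>I\<close> and \<open>y\<close> does not, convexity
  keeps all of \<open>I\<close> below \<open>y\<close>, so \<open>Sup I\<close> lies between them;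
  the other case is the mirror image with \<open>Inf I\<close>.\<close>

lemma is_interval_crossing:
  fixes I :: "real set"
  assumes "is_interval I" "bounded I" "x \<le> y" "(x \<in> I) \<noteq> (y \<in> I)"
  shows "\<exists>e\<in>{Inf I, Sup I}. x \<le> e \<and> e \<le> y"
proof (cases "x \<in> I")
  case True
  with assms have "y \<notin> I" by simp
  have "x \<le> Sup I" using cSup_upper[OF True bounded_imp_bdd_above] assms by simp
  moreover have "Sup I \<le> y"
  proof (rule cSup_least)
    fix z assume "z \<in> I"
    show "z \<le> y"
    proof (rule ccontr)
      assume "\<not> z \<le> y"
      then have "y \<in> I" using assms True \<open>z \<in> I\<close> mem_is_interval_1_I[of I x z y] by simp
      with \<open>y \<notin> I\<close> show False ..
    qed
  qed (use True in auto)
  ultimately show ?thesis by auto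
next
  case False
  with assms have "y \<in> I" by simp
  have "Inf I \<le> y" using cInf_lower[OF \<open>y \<in> I\<close> bounded_imp_bdd_below] assms by simp
  moreover have "x \<le> Inf I"
  proof (rule cInf_greatest)
    fix z assume "z \<in> I"
    show "x \<le> z"
    proof (rule ccontr)
      assume "\<not> x \<le> z"
      then have "x \<in> I" using assms \<open>y \<in> I\<close> \<open>z \<in> I\<close> mem_is_interval_1_I[of I z y x] by simp
      with False show False ..
    qed
  qed (use \<open>y \<in> I\<close> in auto)
  ultimately show ?thesis by auto
qed

lemma finite_lattice_points:
  fixes p :: real
  assumes "bounded S" "0 < p"
  shows "finite {j. 1 \<le> j \<and> real j * p \<in> S}"
proof -
  obtain b where b: "\<And>x. x \<in> S \<Longrightarrow> \<bar>x\<bar> \<le> b" using assms by (auto simp: bounded_iff)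
  have "{j. 1 \<le> j \<and> real j * p \<in> S} \<subseteq> {..nat \<lceil>b / p\<rceil>}"
  proof
    fix j assume "j \<in> {j. 1 \<le> j \<and> real j * p \<in> S}"
    then have "real j * p \<le> b" using b[of "real j * p"] by auto
    then have "real j \<le> b / p" using assms by (simp add: field_simps)
    then show "j \<in> {..nat \<lceil>b / p\<rceil>}" by (simp add: le_nat_iff) linarith
  qed
  then show ?thesis by (rule finite_subset) simp
qed

lemma union_of_bounded_intervals_bounded:
  assumes "union_of_bounded_intervals n S"
  shows "bounded S"
  using assms by (auto simp: union_of_bounded_intervals_def)

lemma union_of_bounded_intervals_borel:
  assumes "union_of_bounded_intervals n S"
  shows "S \<in> sets borel"
  using assms real_interval_borel_measurable by (auto simp: union_of_bounded_intervals_def )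

text \<open>The half-line is tiled by half-open cells of length \<open>p\<close>, each represented
  by its right end point. The union \<open>G\<close> of the cells with a right end point
  \<open>j * p\<close> in \<open>S\<close>, \<open>j \<ge> 1\<close>, has measure
  \<open>card J * p\<close>. Up to the null set \<open>{0}\<close>, it differs from \<open>S\<close>
  only inside cells that contain one of the at most \<open>2 * n\<close> end points of intervals;
  \<open>Z\<close> is the union of those cells.\<close>

lemma lattice_points_measure:
  fixes p :: real
  assumes S: "union_of_bounded_intervals n S" "S \<subseteq> {0..}" and p: "0 < p"
  shows "\<bar>real (card {j. 1 \<le> j \<and> real j * p \<in> S}) * p - measure lborel S\<bar> \<le> 2 * real n * p"
proof -
  define J where "J = {j. 1 \<le> j \<and> real j * p \<in> S}"
  obtain F where F: "finite F" "card F = n" "\<And>I. I \<in> F \<Longrightarrow> is_interval I \<and> bounded I" "S = \<Union>F"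
    using S by (auto simp: union_of_bounded_intervals_def)
  define E where "E = Inf ` F \<union> Sup ` F"
  define cell where "cell m = {(real_of_int m - 1) * p<..real_of_int m * p}" for m :: int
  define G where "G = (\<Union>j\<in>J. cell (int j))"
  define Z where "Z = (\<Union>e\<in>E. cell \<lceil>e / p\<rceil>)"
  have fJ: "finite J" unfolding J_def
    using S p by (intro finite_lattice_points union_of_bounded_intervals_bounded)
  have cell_iff: "x \<in> cell m \<longleftrightarrow> \<lceil>x / p\<rceil> = m" for x m
    using p by (auto simp: cell_def ceiling_eq_iff field_simps)
  have mcell: "measure lborel (cell m) = p" for m
    using p by (simp add: cell_def algebra_simps)
  have fcell: "cell m \<in> fmeasurable lborel" for m
    by (intro fmeasurable_lborel_bounded) (auto simp: cell_def)
  have fE: "finite E" "card E \<le> 2 * n"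
    using F card_image_le[OF F(1), of Inf] card_image_le[OF F(1), of Sup]
      card_Un_le[of "Inf ` F" "Sup ` F"] by (auto simp: E_def)
  have fS: "S \<in> fmeasurable lborel"
    using S by (intro fmeasurable_lborel_bounded union_of_bounded_intervals_borel union_of_bounded_intervals_bounded)
  have fG: "G \<in> fmeasurable lborel" and fZ: "Z \<in> fmeasurable lborel"
    using fJ fE fcell by (auto simp: G_def Z_def)
  have "measure lborel G = (\<Sum>j\<in>J. measure lborel (cell (int j)))"
    unfolding G_def
  proof (rule measure_finite_Union[OF fJ])
    show "disjoint_family_on (\<lambda>j. cell (int j)) J" by (auto simp: disjoint_family_on_def cell_iff)
  qed (use fcell in \<open>auto simp: fmeasurable_def less_top\<close>)
  then have mG: "measure lborel G = real (card J) * p" by (simp add: mcell)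
  have "measure lborel Z \<le> (\<Sum>e\<in>E. measure lborel (cell \<lceil>e / p\<rceil>))"
    unfolding Z_def using fE fcell by (intro measure_UNION_le fmeasurableD)
  also have "\<dots> \<le> 2 * real n * p" using fE p by (simp add: mcell)
  finally have mZ: "measure lborel Z \<le> 2 * real n * p" .
  \<comment> \<open>If \<open>x\<close> and the right end point of its cell disagree about
    \<open>S\<close>, they disagree about one of the intervals, and an end point of that interval
    lies between them, in the same cell.\<close>
  have cross: "x \<in> Z" if x: "x \<in> cell m" "(x \<in> S) \<noteq> (real_of_int m * p \<in> S)" for x m
  proof -
    obtain I where I: "I \<in> F" "(x \<in> I) \<noteq> (real_of_int m * p \<in> I)" using x(2) F(4) by blast
    obtain e where e: "e \<in> {Inf I, Sup I}" "x \<le> e" "e \<le> real_of_int m * p"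
      using is_interval_crossing[of I x "real_of_int m * p"] I F x(1) by (auto simp: cell_def)
    have "e \<in> cell m" using e that by (auto simp: cell_def)
    then have "x \<in> cell \<lceil>e / p\<rceil>" using that by (simp add: cell_iff)
    moreover have "e \<in> E" using e I by (auto simp: E_def)
    ultimately show ?thesis unfolding Z_def by blast
  qed
  have "G \<subseteq> S \<union> Z"
  proof
    fix x assume "x \<in> G"
    then obtain j where "x \<in> cell (int j)" "real j * p \<in> S" by (auto simp: G_def J_def)
    then show "x \<in> S \<union> Z" using cross[of x "int j"] by auto
  qed
  then have "measure lborel G \<le> measure lborel (S \<union> Z)"
    using fG fS fZ by (intro measure_mono_fmeasurable) auto
  also have "\<dots> \<le> measure lborel S + measure lborel Z"
    using fS fZ by (intro measure_Un_le) auto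
  finally have 1: "measure lborel G \<le> measure lborel S + measure lborel Z" .
  \<comment> \<open>Positions start at 1, so the cell of index 0, which contains the point 0, is not
    part of \<open>G\<close>. Within \<open>S\<close> only the null set \<open>{0}\<close> is
    affected.\<close>
  have "S \<subseteq> (G \<union> Z) \<union> {0}"
  proof
    fix x assume "x \<in> S"
    show "x \<in> (G \<union> Z) \<union> {0}"
    proof (cases "x = 0")
      case False
      then have "0 < x" using S \<open>x \<in> S\<close> by force
      then have "0 < \<lceil>x / p\<rceil>" using p by simp
      then obtain j where j: "\<lceil>x / p\<rceil> = int j" "1 \<le> j"
        by (metis Suc_leI One_nat_def int_one_le_iff_zero_less of_nat_1 of_nat_le_iff zero_less_imp_eq_int)
      have xc: "x \<in> cell (int j)" using j by (simp add: cell_iff)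
      show ?thesis
      proof (cases "real j * p \<in> S")
        case True
        then show ?thesis using xc j by (auto simp: G_def J_def)
      next
        case False
        then show ?thesis using cross[OF xc] \<open>x \<in> S\<close> by simp
      qed
    qed simp
  qed
  then have "measure lborel S \<le> measure lborel ((G \<union> Z) \<union> {0})"
    using fG fS fZ by (intro measure_mono_fmeasurable fmeasurable.Un) (auto intro: fmeasurable_lborel_bounded)
  also have "\<dots> \<le> measure lborel (G \<union> Z) + measure lborel {0::real}"
    using fmeasurableD[OF fmeasurable.Un[OF fG fZ]] by (intro measure_Un_le) auto
  also have "\<dots> \<le> measure lborel G + measure lborel Z"
    using measure_Un_le[OF fmeasurableD[OF fG] fmeasurableD[OF fZ]] by simp
  finally show ?thesis using 1 mZ mG by (simp add: J_def)
qed

subsection \<open>The Chen--Stein bound\<close>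

lemma measurable_sum_nat:
  fixes X :: "'i \<Rightarrow> 'a \<Rightarrow> nat"
  assumes "\<And>i. i \<in> J \<Longrightarrow> X i \<in> measurable M (count_space UNIV)"
  shows "(\<lambda>x. \<Sum>i\<in>J. X i x) \<in> measurable M (count_space UNIV)"
  using assms
proof (induction J rule: infinite_finite_induct)
  case (insert i J)
  have [measurable]: "X i \<in> measurable M (count_space UNIV)"
    "(\<lambda>x. \<Sum>i\<in>J. X i x) \<in> measurable M (count_space UNIV)"
    using insert by auto
  show ?case using insert(1,2) by simp
qed auto

text \<open>The three terms on the right bound, in this order, the expectations of
  \<open>D1 i\<close>, \<open>D2 i\<close> and \<open>D3 i\<close> below. The common factor
  \<open>2 * exp\<close> of the mean is the bound on the Stein solution, and the factors 2 arise
  because its differences are at most twice that bound.\<close>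

lemma (in prob_space) chen_stein:
  fixes X :: "'i \<Rightarrow> 'a \<Rightarrow> nat" and N :: "'i \<Rightarrow> 'i set"
  assumes J: "finite J"
    and X: "\<And>i. i \<in> J \<Longrightarrow> X i \<in> measurable M (count_space UNIV)"
    and X01: "\<And>i x. X i x \<le> 1"
    and p: "\<And>i. i \<in> J \<Longrightarrow> expectation (\<lambda>x. real (X i x)) = p i"
    and N: "\<And>i. i \<in> J \<Longrightarrow> i \<in> N i \<and> N i \<subseteq> J"
    and \<eta>: "\<And>i \<phi>. i \<in> J \<Longrightarrow> (\<And>j. \<bar>\<phi> j\<bar> \<le> 1) \<Longrightarrow>
        \<bar>expectation (\<lambda>x. (real (X i x) - p i) * \<phi> (\<Sum>j\<in>J - N i. X j x))\<bar> \<le> \<eta> i"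
    and pos: "0 < (\<Sum>i\<in>J. p i)"
    and h: "\<And>j. \<bar>h j\<bar> \<le> 1"
  shows "\<bar>expectation (\<lambda>x. h (\<Sum>i\<in>J. X i x)) - poisson_avg (\<Sum>i\<in>J. p i) h\<bar>
    \<le> 2 * exp (\<Sum>i\<in>J. p i) * (\<Sum>i\<in>J. 2 * p i * (\<Sum>j\<in>N i. p j)
        + 2 * (\<Sum>j\<in>N i - {i}. expectation (\<lambda>x. real (X i x) * real (X j x))) + \<eta> i)"
proof -
  define lam where "lam = (\<Sum>i\<in>J. p i)"
  obtain f where f: "\<And>j. \<bar>f j\<bar> \<le> 2 * exp lam"
    and steq: "\<And>j. lam * f (Suc j) - real j * f j = h j - poisson_avg lam h"
    using stein_equation_solution[of lam h] pos h unfolding lam_def by blast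
  define B where "B = 2 * exp lam"
  have B: "0 < B" "\<And>j. \<bar>f j\<bar> \<le> B" using f by (auto simp: B_def)
  have fdiff: "\<bar>f a - f b\<bar> \<le> 2 * B" for a b using B(2)[of a] B(2)[of b] by linarith
  define W where "W x = (\<Sum>i\<in>J. X i x)" for x
  define V where "V i x = (\<Sum>j\<in>J - N i. X j x)" for i x
  have X_le1: "real (X i x) \<le> 1" for i x using X01[of i x] by linarith
  have mW [measurable]: "W \<in> measurable M (count_space UNIV)"
    unfolding W_def using X by (rule measurable_sum_nat)
  have mV [measurable]: "V i \<in> measurable M (count_space UNIV)" for i
    unfolding V_def using X by (intro measurable_sum_nat) auto
  have bint: "integrable M g" if "g \<in> borel_measurable M" "\<And>x. \<bar>g x\<bar> \<le> b" for g :: "'a \<Rightarrow> real" and b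
    using that by (intro integrable_const_bound[of _ b]) auto
  have p0: "0 \<le> p i" if "i \<in> J" for i unfolding p[OF that, symmetric] by (rule Bochner_Integration.integral_nonneg) simp
  \<comment> \<open>\<open>D i\<close> is the share of index \<open>i\<close> in the Stein
    expression, and \<open>V i\<close> is the count outside \<open>N i\<close>. \<open>D1\<close>
    vanishes unless some index in \<open>N i\<close> is hit, \<open>D2\<close> unless
    \<open>i\<close> and another index in \<open>N i\<close> are both hit, and \<open>D3\<close>
    couples \<open>X i\<close> to the distant count alone.\<close>
  define D where "D i x = p i * f (Suc (W x)) - real (X i x) * f (W x)" for i x
  define D1 where "D1 i x = p i * (f (Suc (W x)) - f (Suc (V i x)))" for i x
  define D2 where "D2 i x = real (X i x) * (f (Suc (V i x)) - f (W x))" for i x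
  define D3 where "D3 i x = (real (X i x) - p i) * f (Suc (V i x))" for i x
  have split: "D i x = D1 i x + D2 i x - D3 i x" for i x
    by (simp add: D_def D1_def D2_def D3_def algebra_simps)
  have WV: "W x = V i x + (\<Sum>j\<in>N i. X j x)" if "i \<in> J" for i x
    unfolding W_def V_def using N[OF that] J by (intro sum.subset_diff) auto
  have fN: "finite (N i)" if "i \<in> J" for i using N[OF that] J finite_subset by auto
  have bound: "\<bar>expectation (D i)\<bar> \<le> B * (2 * p i * (\<Sum>j\<in>N i. p j)
        + 2 * (\<Sum>j\<in>N i - {i}. expectation (\<lambda>x. real (X i x) * real (X j x))) + \<eta> i)"
    and intD: "integrable M (D i)" if i: "i \<in> J" for i
  proof -
    have mX [measurable]: "X j \<in> measurable M (count_space UNIV)" if "j \<in> N i" for j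
      using X N[OF i] that by auto
    have mXi [measurable]: "X i \<in> measurable M (count_space UNIV)" using X i by auto
    have [measurable]: "D1 i \<in> borel_measurable M" "D2 i \<in> borel_measurable M" "D3 i \<in> borel_measurable M"
      unfolding D1_def[abs_def] D2_def[abs_def] D3_def[abs_def] by measurable
    have i1: "integrable M (D1 i)"
    proof (rule bint[of _ "p i * (2 * B)"])
      show "\<bar>D1 i x\<bar> \<le> p i * (2 * B)" for x
        using p0[OF i] fdiff by (simp add: D1_def abs_mult mult_left_mono)
    qed simp
    have i2: "integrable M (D2 i)"
    proof (rule bint[of _ "1 * (2 * B)"])
      show "\<bar>D2 i x\<bar> \<le> 1 * (2 * B)" for x
        unfolding D2_def abs_mult using fdiff X_le1[of i x] by (intro mult_mono) auto
    qed simp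
    have i3: "integrable M (D3 i)"
    proof (rule bint[of _ "(1 + p i) * B"])
      show "\<bar>D3 i x\<bar> \<le> (1 + p i) * B" for x
        unfolding D3_def abs_mult using B X_le1[of i x] p0[OF i] by (intro mult_mono) auto
    qed simp
    have iX: "integrable M (\<lambda>x. real (X j x))" if "j \<in> N i" for j
      using mX[OF that] X_le1 by (intro bint[of _ 1]) auto
    have iXX: "integrable M (\<lambda>x. real (X i x) * real (X j x))" if "j \<in> N i" for j
      using mX[OF that] X_le1 by (intro bint[of _ 1]) (auto simp: mult_le_one)
    have "\<bar>expectation (D1 i)\<bar> \<le> expectation (\<lambda>x. \<Sum>j\<in>N i. p i * (2 * B) * real (X j x))"
    proof (rule order_trans[OF integral_abs_bound], rule integral_mono)
      show "\<bar>D1 i x\<bar> \<le> (\<Sum>j\<in>N i. p i * (2 * B) * real (X j x))" for x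
      proof (cases "\<exists>j\<in>N i. X j x \<noteq> 0")
        case True
        then obtain j where j: "j \<in> N i" "X j x = 1" using X01 by (metis le_neq_implies_less less_one)
        have "\<bar>D1 i x\<bar> \<le> p i * (2 * B)"
          using p0[OF i] fdiff by (simp add: D1_def abs_mult mult_left_mono)
        also have "\<dots> = p i * (2 * B) * real (X j x)" using j by simp
        also have "\<dots> \<le> (\<Sum>j\<in>N i. p i * (2 * B) * real (X j x))"
          using p0[OF i] B fN[OF i] j by (intro member_le_sum) auto
        finally show ?thesis .
      next
        case False
        then have "W x = V i x" using WV[OF i] by simp
        then show ?thesis using p0[OF i] B by (auto simp: D1_def intro!: sum_nonneg)
      qed
      show "integrable M (\<lambda>x. \<Sum>j\<in>N i. p i * (2 * B) * real (X j x))"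
        using iX by (intro Bochner_Integration.integrable_sum integrable_mult_right) auto
    qed (use i1 in auto)
    also have "\<dots> = (\<Sum>j\<in>N i. p i * (2 * B) * p j)"
      using iX N[OF i] p by (subst Bochner_Integration.integral_sum) (auto intro!: sum.cong)
    also have "\<dots> = B * (2 * p i * (\<Sum>j\<in>N i. p j))"
      by (simp add: sum_distrib_left mult_ac)
    finally have 1: "\<bar>expectation (D1 i)\<bar> \<le> B * (2 * p i * (\<Sum>j\<in>N i. p j))" .
    have "\<bar>expectation (D2 i)\<bar> \<le> expectation (\<lambda>x. \<Sum>j\<in>N i - {i}. (2 * B) * (real (X i x) * real (X j x)))"
    proof (rule order_trans[OF integral_abs_bound], rule integral_mono)
      show "\<bar>D2 i x\<bar> \<le> (\<Sum>j\<in>N i - {i}. (2 * B) * (real (X i x) * real (X j x)))" for x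
      proof (cases "X i x = 0")
        case False
        then have Xi: "X i x = 1" using X01[of i x] by linarith
        show ?thesis
        proof (cases "\<exists>j\<in>N i - {i}. X j x \<noteq> 0")
          case True
          then obtain j where j: "j \<in> N i - {i}" "X j x = 1" using X01 by (metis le_neq_implies_less less_one)
          have "\<bar>D2 i x\<bar> \<le> 2 * B" using fdiff by (simp add: D2_def Xi)
          also have "\<dots> = (2 * B) * (real (X i x) * real (X j x))" using j Xi by simp
          also have "\<dots> \<le> (\<Sum>j\<in>N i - {i}. (2 * B) * (real (X i x) * real (X j x)))"
            using B fN[OF i] j by (intro member_le_sum) auto
          finally show ?thesis .
        next
          case False
          \<comment> \<open>Inside \<open>N i\<close> only \<open>i\<close> itself is hit, so
            \<open>W\<close> exceeds \<open>V i\<close> by exactly 1 and \<open>D2\<close>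
            vanishes.\<close>
          then have "(\<Sum>j\<in>N i. X j x) = 1"
            using Xi N[OF i] fN[OF i] by (subst sum.remove[of _ i]) auto
          then have "W x = Suc (V i x)" using WV[OF i] by simp
          then show ?thesis using B by (auto simp: D2_def intro!: sum_nonneg)
        qed
      qed (use B in \<open>auto simp: D2_def intro!: sum_nonneg\<close>)
      show "integrable M (\<lambda>x. \<Sum>j\<in>N i - {i}. (2 * B) * (real (X i x) * real (X j x)))"
        using iXX by (intro Bochner_Integration.integrable_sum integrable_mult_right) auto
    qed (use i2 in auto)
    also have "\<dots> = (\<Sum>j\<in>N i - {i}. (2 * B) * expectation (\<lambda>x. real (X i x) * real (X j x)))"
      using iXX by (subst Bochner_Integration.integral_sum) (auto intro!: sum.cong integrable_mult_right)
    also have "\<dots> = B * (2 * (\<Sum>j\<in>N i - {i}. expectation (\<lambda>x. real (X i x) * real (X j x))))"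
      by (simp add: sum_distrib_left mult_ac)
    finally have 2: "\<bar>expectation (D2 i)\<bar> \<le> B * (2 * (\<Sum>j\<in>N i - {i}. expectation (\<lambda>x. real (X i x) * real (X j x))))" .
    \<comment> \<open>Division by \<open>B\<close> makes the Stein solution an admissible test
      function for the hypothesis on \<open>\<eta>\<close>.\<close>
    have "\<bar>expectation (\<lambda>x. (real (X i x) - p i) * (\<lambda>v. f (Suc v) / B) (\<Sum>j\<in>J - N i. X j x))\<bar> \<le> \<eta> i"
      using B by (intro \<eta>[OF i]) (auto simp: field_simps)
    also have "(\<lambda>x. (real (X i x) - p i) * (\<lambda>v. f (Suc v) / B) (\<Sum>j\<in>J - N i. X j x)) = (\<lambda>x. D3 i x / B)"
      by (simp add: D3_def V_def)
    finally have 3: "\<bar>expectation (D3 i)\<bar> \<le> B * \<eta> i" using B by (simp add: field_simps)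
    have D: "D i = (\<lambda>x. D1 i x + D2 i x - D3 i x)" using split by auto
    show "integrable M (D i)" unfolding D using i1 i2 i3 by auto
    have "expectation (D i) = expectation (D1 i) + expectation (D2 i) - expectation (D3 i)"
      unfolding D using i1 i2 i3 by simp
    then show "\<bar>expectation (D i)\<bar> \<le> B * (2 * p i * (\<Sum>j\<in>N i. p j)
        + 2 * (\<Sum>j\<in>N i - {i}. expectation (\<lambda>x. real (X i x) * real (X j x))) + \<eta> i)"
      using 1 2 3 unfolding distrib_left by linarith
  qed
  have "h (W x) - poisson_avg lam h = (\<Sum>i\<in>J. D i x)" for x
    unfolding steq[symmetric] by (simp add: D_def sum_subtractf lam_def W_def sum_distrib_right)
  then have hW: "(\<lambda>x. h (W x) - poisson_avg lam h) = (\<lambda>x. \<Sum>i\<in>J. D i x)" by auto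
  have "integrable M (\<lambda>x. h (W x))" using h by (intro bint[of _ 1]) auto
  then have "expectation (\<lambda>x. h (W x)) - poisson_avg lam h = expectation (\<lambda>x. h (W x) - poisson_avg lam h)"
    by (simp add: prob_space)
  also have "\<dots> = (\<Sum>i\<in>J. expectation (D i))"
    unfolding hW using intD by (intro Bochner_Integration.integral_sum)
  finally have "\<bar>expectation (\<lambda>x. h (W x)) - poisson_avg lam h\<bar> \<le> (\<Sum>i\<in>J. \<bar>expectation (D i)\<bar>)"
    using sum_abs by metis
  also have "\<dots> \<le> (\<Sum>i\<in>J. B * (2 * p i * (\<Sum>j\<in>N i. p j)
        + 2 * (\<Sum>j\<in>N i - {i}. expectation (\<lambda>x. real (X i x) * real (X j x))) + \<eta> i))"
    using bound by (rule sum_mono)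
  finally show ?thesis
    by (simp only: W_def lam_def B_def sum_distrib_left[symmetric])
qed

text \<open>The expectation is expanded over the values \<open>u\<close> of \<open>U\<close> and
  \<open>v\<close> of \<open>V\<close>. Because the error in \<open>ind\<close> is weighted by the
  product of the two marginals, these weights sum to 1, and the bound does not depend on the number
  \<open>m\<close> of values.\<close>

lemma (in prob_space) almost_independent_expectation:
  fixes U V :: "'a \<Rightarrow> nat" and \<phi> :: "nat \<Rightarrow> nat \<Rightarrow> real"
  assumes U: "U \<in> measurable M (count_space UNIV)" "\<And>x. U x \<le> m"
    and V: "V \<in> measurable M (count_space UNIV)" "\<And>x. V x \<le> m"
    and B: "B \<in> events"
    and ind: "\<And>u v. \<bar>prob (B \<inter> ({x \<in> space M. U x = u} \<inter> {x \<in> space M. V x = v}))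
        - prob B * prob ({x \<in> space M. U x = u} \<inter> {x \<in> space M. V x = v})\<bar>
        \<le> \<epsilon> * (prob {x \<in> space M. U x = u} * prob {x \<in> space M. V x = v})"
    and \<phi>: "\<And>u v. \<bar>\<phi> u v\<bar> \<le> 1"
  shows "\<bar>expectation (\<lambda>x. (indicator B x - prob B) * \<phi> (U x) (V x))\<bar> \<le> \<epsilon>"
proof -
  define E where "E u = {x \<in> space M. U x = u}" for u
  define F where "F v = {x \<in> space M. V x = v}" for v
  have [measurable]: "E u \<in> events" "F u \<in> events" "B \<in> events" for u
    using U V B by (auto simp: E_def F_def)
  have tot: "(\<Sum>u\<le>m. prob {x \<in> space M. Y x = u}) = 1"
    if "Y \<in> measurable M (count_space UNIV)" "\<And>x. Y x \<le> m" for Y :: "'a \<Rightarrow> nat"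
  proof -
    have "(\<Sum>u\<le>m. prob {x \<in> space M. Y x = u}) = prob (\<Union>u\<in>{..m}. {x \<in> space M. Y x = u})"
      using that by (intro finite_measure_finite_Union[symmetric]) (auto simp: disjoint_family_on_def)
    also have "(\<Union>u\<in>{..m}. {x \<in> space M. Y x = u}) = space M" using that by auto
    finally show ?thesis by (simp add: prob_space)
  qed
  have "expectation (\<lambda>x. (indicator B x - prob B) * \<phi> (U x) (V x))
      = expectation (\<lambda>x. \<Sum>u\<le>m. \<Sum>v\<le>m. \<phi> u v * (indicator (B \<inter> (E u \<inter> F v)) x - prob B * indicator (E u \<inter> F v) x))"
  proof (rule Bochner_Integration.integral_cong)
    fix x assume x: "x \<in> space M"
    \<comment> \<open>At each \<open>x\<close> exactly one pair of values is attained, so the double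
      sum collapses to one term.\<close>
    have "(\<Sum>u\<le>m. \<Sum>v\<le>m. \<phi> u v * (indicator (B \<inter> (E u \<inter> F v)) x - prob B * indicator (E u \<inter> F v) x))
        = (\<Sum>u\<le>m. \<Sum>v\<le>m. if v = V x then (if u = U x then \<phi> u v * (indicator B x - prob B) else 0) else 0)"
      using x by (intro sum.cong refl) (auto simp: E_def F_def indicator_def)
    also have "\<dots> = (indicator B x - prob B) * \<phi> (U x) (V x)"
      using U(2)[of x] V(2)[of x] by simp
    finally show "(indicator B x - prob B) * \<phi> (U x) (V x) = (\<Sum>u\<le>m. \<Sum>v\<le>m. \<phi> u v * (indicator (B \<inter> (E u \<inter> F v)) x - prob B * indicator (E u \<inter> F v) x))" by simp
  qed simp
  also have "\<dots> = (\<Sum>u\<le>m. \<Sum>v\<le>m. \<phi> u v * (prob (B \<inter> (E u \<inter> F v)) - prob B * prob (E u \<inter> F v)))"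
  proof -
    have i: "integrable M (\<lambda>x. \<phi> u v * (indicator (B \<inter> (E u \<inter> F v)) x - prob B * indicator (E u \<inter> F v) x))" for u v
      by (intro integrable_mult_right Bochner_Integration.integrable_diff) (simp_all add: less_top[symmetric])
    show ?thesis
      by (simp add: Bochner_Integration.integral_sum Bochner_Integration.integrable_sum i less_top[symmetric])
  qed
  also have "\<bar>\<dots>\<bar> \<le> (\<Sum>u\<le>m. \<Sum>v\<le>m. \<bar>\<phi> u v * (prob (B \<inter> (E u \<inter> F v)) - prob B * prob (E u \<inter> F v))\<bar>)"
    by (rule order_trans[OF sum_abs sum_mono]) (rule sum_abs)
  also have "\<dots> \<le> (\<Sum>u\<le>m. \<Sum>v\<le>m. \<epsilon> * (prob (E u) * prob (F v)))"
  proof (intro sum_mono)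
    fix u v
    have "\<bar>\<phi> u v * (prob (B \<inter> (E u \<inter> F v)) - prob B * prob (E u \<inter> F v))\<bar>
       \<le> 1 * \<bar>prob (B \<inter> (E u \<inter> F v)) - prob B * prob (E u \<inter> F v)\<bar>"
      unfolding abs_mult using \<phi> by (intro mult_right_mono) auto
    also have "\<dots> \<le> \<epsilon> * (prob (E u) * prob (F v))" using ind[of u v] by (simp add: E_def F_def)
    finally show "\<bar>\<phi> u v * (prob (B \<inter> (E u \<inter> F v)) - prob B * prob (E u \<inter> F v))\<bar> \<le> \<epsilon> * (prob (E u) * prob (F v))" .
  qed
  also have "\<dots> = \<epsilon> * ((\<Sum>u\<le>m. prob (E u)) * (\<Sum>v\<le>m. prob (F v)))"
    unfolding sum_product by (simp only: sum_distrib_left)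
  also have "\<dots> = \<epsilon>" using tot[OF U] tot[OF V] by (simp add: E_def F_def)
  finally show ?thesis .
qed

subsection \<open>Occurrences of words under a mixing measure\<close>

text \<open>With \<open>F\<close> reading a finite window of a sequence, this replaces measurability
  with respect to that window: over a countable alphabet such a set is a countable union of
  cylinders.\<close>

definition determined_by :: "('a \<Rightarrow> 'b) \<Rightarrow> 'a set \<Rightarrow> bool" where
  "determined_by F A \<longleftrightarrow> (\<forall>x y. F x = F y \<longrightarrow> x \<in> A \<longrightarrow> y \<in> A)"

lemma determined_byI: "(\<And>x y. F x = F y \<Longrightarrow> x \<in> A \<Longrightarrow> y \<in> A) \<Longrightarrow> determined_by F A"
  unfolding determined_by_def by blast

lemma determined_byD: "determined_by F A \<Longrightarrow> F x = F y \<Longrightarrow> x \<in> A \<Longrightarrow> y \<in> A"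
  unfolding determined_by_def by blast

lemma determined_by_UN:
  assumes "determined_by F A"
  shows "A = (\<Union>u\<in>F ` A. {x. F x = u})"
proof (intro equalityI subsetI)
  fix x assume "x \<in> (\<Union>u\<in>F ` A. {x. F x = u})"
  then obtain a where "a \<in> A" "F a = F x" by auto
  then show "x \<in> A" using determined_byD[OF assms] by blast
qed auto

lemma determined_by_mono:
  assumes "determined_by F A" "\<And>x y. G x = G y \<Longrightarrow> F x = F y"
  shows "determined_by G A"
  using assms unfolding determined_by_def by blast

lemma determined_by_Int:
  "determined_by F A \<Longrightarrow> determined_by F B \<Longrightarrow> determined_by F (A \<inter> B)"
  unfolding determined_by_def by blast

section \<open>Windows of a sequence and occurrences of words in them\<close>

lemma stake_eq_prefix: "stake n x = stake n y \<Longrightarrow> m \<le> n \<Longrightarrow> stake m x = stake m y"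
  by (metis min.absorb1 take_stake)

lemma stake_sdrop_eq:
  assumes "stake n x = stake n y" "m + k \<le> n"
  shows "stake k (sdrop m x) = stake k (sdrop m y)"
proof -
  have "stake (m + k) x = stake (m + k) y" using assms by (rule stake_eq_prefix)
  then have "drop m (stake (m + k) x) = drop m (stake (m + k) y)" by simp
  then show ?thesis by (simp add: drop_stake)
qed

lemma occ_le_1: "occ j x w \<le> 1"
  by (simp add: occ_def)

lemma occ_eq_1_iff: "occ j x w = 1 \<longleftrightarrow> stake (length w) (sdrop (j - 1) x) = w"
  by (simp add: occ_def)

lemma occ_eq_indicator: "real (occ j x w) = indicator {x. occ j x w = 1} x"
  by (simp add: occ_def)

text \<open>The last condition says that the copy of \<open>w\<close> at \<open>j\<close> ends
  inside the window of length \<open>n\<close> that starts at \<open>l\<close>. The choice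
  \<open>l = 1\<close> serves the past of a position, a larger \<open>l\<close> its future.\<close>

lemma occ_cong:
  assumes "1 \<le> l" "l \<le> j" "stake n (sdrop (l - 1) x) = stake n (sdrop (l - 1) y)" "j + length w \<le> n + l"
  shows "occ j x w = occ j y w"
proof -
  have "stake (length w) (sdrop (j - l) (sdrop (l - 1) x)) = stake (length w) (sdrop (j - l) (sdrop (l - 1) y))"
    using assms(3) by (rule stake_sdrop_eq) (use assms in auto)
  moreover have "l - 1 + (j - l) = j - 1" using assms by simp
  ultimately show ?thesis by (simp add: occ_def add.commute)
qed

text \<open>On the overlap the same letters of \<open>x\<close> are read once from each copy of
  \<open>w\<close>, so \<open>w\<close> agrees with its own shift by \<open>l\<close>.\<close>

lemma period_of_overlap:
  assumes "occ i x w = 1" "occ (i + l) x w = 1" "1 \<le> i" "1 \<le> l" "l < length w"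
  shows "l \<in> periods w"
proof -
  have nth: "w ! a = x !! (j - 1 + a)" if "occ j x w = 1" "a < length w" for j a
  proof -
    have "w ! a = stake (length w) (sdrop (j - 1) x) ! a"
      using that(1) unfolding occ_eq_1_iff by simp
    also have "\<dots> = x !! (j - 1 + a)" using that(2) by (simp add: sdrop_snth)
    finally show ?thesis .
  qed
  have "w ! (a - 1) = w ! (a + l - 1)" if "1 \<le> a" "a \<le> length w - l" for a
    using nth[OF assms(1), of "a + l - 1"] nth[OF assms(2), of "a - 1"] that assms
    by (simp add: algebra_simps)
  then show ?thesis using assms by (auto simp: periods_def)
qed

text \<open>There are countably many words of length \<open>n\<close>, so \<open>A\<close> is a
  countable union of generators. The index is \<open>Suc n\<close> because a block algebra excludes
  its right end position.\<close>

lemma block_algebraI: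
  fixes A :: "'a::countable stream set"
  assumes "determined_by (stake n) A"
  shows "A \<in> block_algebra 1 (Suc n)"
proof -
  have "(\<Union>u\<in>stake n ` A. {x. stake n x = u}) \<in> block_algebra 1 (Suc n)"
    unfolding block_algebra_def
  proof (rule sigma_sets_UNION)
    fix B assume "B \<in> (\<lambda>u. {x. stake n x = u}) ` stake n ` A"
    then obtain u :: "'a list" where u: "B = {x. stake n x = u}" "length u = n" by auto
    then have "B = {x. occ 1 x u = 1}" "length u = Suc n - 1" by (simp_all add: occ_def)
    then show "B \<in> sigma_sets UNIV {{x. occ 1 x w = 1} |w. length w = Suc n - 1}"
      by (intro sigma_sets.Basic) blast
  qed auto
  then show ?thesis using determined_by_UN[OF assms] by simp
qed

lemma tail_algebraI:
  fixes A :: "'a::countable stream set"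
  assumes "determined_by (\<lambda>x. stake n (sdrop (l - 1) x)) A"
  shows "A \<in> tail_algebra l"
proof -
  define F :: "'a stream \<Rightarrow> 'a list" where "F = (\<lambda>x. stake n (sdrop (l - 1) x))"
  have "(\<Union>u\<in>F ` A. {x. F x = u}) \<in> tail_algebra l"
    unfolding tail_algebra_def
  proof (rule sigma_sets_UNION)
    fix B assume "B \<in> (\<lambda>u. {x. F x = u}) ` F ` A"
    then obtain u :: "'a list" where "B = {x. F x = u}" "length u = n" by (auto simp: F_def)
    then have "B = {x. occ l x u = 1}" by (simp add: occ_def F_def)
    then show "B \<in> sigma_sets UNIV {{x. occ l x w = 1} |w. True}"
      by (intro sigma_sets.Basic) blast
  qed auto
  then show ?thesis using determined_by_UN[of F A] assms by (simp add: F_def)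
qed

section \<open>Estimates under fixed mixing and contraction constants\<close>

locale mixing_process = prob_space \<mu>
  for \<mu> :: "'a::countable stream measure" +
  fixes \<sigma> T \<rho> K :: real
  assumes sets_\<mu>: "sets \<mu> = sets (stream_space (count_space UNIV))"
    and invariant: "word_invariant \<mu>"
    and \<sigma>: "0 < \<sigma>" "\<sigma> < 1" and T: "0 < T"
    and mixing: "\<And>k l A B. \<lbrakk>1 \<le> k; k < l; A \<in> block_algebra 1 k; B \<in> tail_algebra l;
        prob A \<noteq> 0; prob B \<noteq> 0\<rbrakk>
      \<Longrightarrow> \<bar>prob (A \<inter> B) / (prob A * prob B) - 1\<bar> \<le> T * \<sigma> ^ (l - k)"
    and \<rho>: "0 < \<rho>" "\<rho> < 1" and K: "0 < K"
    and contraction: "\<And>w. w \<noteq> [] \<Longrightarrow> word_prob \<mu> w \<le> K * \<rho> ^ length w"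
begin

lemma space_\<mu> [simp]: "space \<mu> = UNIV"
  using sets_eq_imp_space_eq[OF sets_\<mu>] by (simp add: space_stream_space)

lemma measurable_stake_\<mu>: "stake n \<in> measurable \<mu> (count_space UNIV)"
  using measurable_cong_sets[OF sets_\<mu> refl] measurable_stake by blast

lemma determined_by_stake_event:
  assumes "determined_by (stake n) A"
  shows "A \<in> events"
proof -
  have "A = stake n -` (stake n ` A) \<inter> space \<mu>"
    by (subst (1) determined_by_UN[OF assms]) auto
  then show ?thesis using measurable_sets[OF measurable_stake_\<mu>, of "stake n ` A" n] by simp
qed

lemma determined_by_sdrop_event:
  assumes "determined_by (\<lambda>x. stake n (sdrop m x)) A"
  shows "A \<in> events"
proof (rule determined_by_stake_event)
  show "determined_by (stake (m + n)) A"
    using assms by (rule determined_by_mono) (auto intro: stake_sdrop_eq)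
qed

text \<open>The case \<open>n = 0\<close>, where no gap is needed because \<open>A\<close> is trivial, serves positions so close to
  the left end that nothing precedes them.\<close>

lemma psi_mixing_product:
  assumes A: "determined_by (stake n) A"
    and B: "determined_by (\<lambda>x. stake m (sdrop (l - 1) x)) B"
    and gap: "n = 0 \<or> n + g < l" "1 \<le> g"
  shows "\<bar>prob (A \<inter> B) - prob A * prob B\<bar> \<le> T * \<sigma> ^ g * (prob A * prob B)"
proof -
  have ev: "A \<in> events" "B \<in> events"
    using determined_by_stake_event[OF A] determined_by_sdrop_event[OF B] .
  have nn: "0 \<le> T * \<sigma> ^ g * (prob A * prob B)" using T \<sigma> by simp
  \<comment> \<open>The mixing condition concerns a quotient, so null events are treated apart; for
    them both sides vanish.\<close>
  consider "n = 0" | "n + g < l" "prob A = 0" | "n + g < l" "prob B = 0"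
    | "n + g < l" "prob A \<noteq> 0" "prob B \<noteq> 0" using gap by blast
  then show ?thesis
  proof cases
    case 1
    then have "A = {} \<or> A = UNIV" using A unfolding determined_by_def by auto
    then show ?thesis using nn prob_space by auto
  next
    case 2
    then have "prob (A \<inter> B) = 0"
      using finite_measure_mono[of "A \<inter> B" A] ev measure_nonneg[of \<mu> "A \<inter> B"] by simp
    then show ?thesis using 2 by simp
  next
    case 3
    then have "prob (A \<inter> B) = 0"
      using finite_measure_mono[of "A \<inter> B" B] ev measure_nonneg[of \<mu> "A \<inter> B"] by simp
    then show ?thesis using 3 by simp
  next
    case 4
    have pos: "0 < prob A * prob B" using 4 by (simp add: zero_less_measure_iff)
    have "\<bar>prob (A \<inter> B) / (prob A * prob B) - 1\<bar> \<le> T * \<sigma> ^ (l - Suc n)"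
      using 4 mixing[OF _ _ block_algebraI[OF A] tail_algebraI[OF B]] gap by simp
    also have "\<dots> \<le> T * \<sigma> ^ g"
      using T \<sigma> 4 by (intro mult_left_mono power_decreasing) auto
    finally have "\<bar>prob (A \<inter> B) / (prob A * prob B) - 1\<bar> * (prob A * prob B) \<le> T * \<sigma> ^ g * (prob A * prob B)"
      using pos by (intro mult_right_mono) auto
    moreover have "\<bar>prob (A \<inter> B) / (prob A * prob B) - 1\<bar> * (prob A * prob B)
        = \<bar>(prob (A \<inter> B) / (prob A * prob B) - 1) * (prob A * prob B)\<bar>"
      using pos by (simp add: abs_mult)
    moreover have "(prob (A \<inter> B) / (prob A * prob B) - 1) * (prob A * prob B) = prob (A \<inter> B) - prob A * prob B"
      using 4 by (simp add: field_simps)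
    ultimately show ?thesis by simp
  qed
qed

text \<open>One-sided mixing is applied three times, to \<open>A\<close> against
  \<open>B \<inter> C\<close>, to \<open>B\<close> against \<open>C\<close> and to \<open>A\<close>
  against \<open>C\<close>. With \<open>d = T * \<sigma> ^ g\<close> the errors add up to
  \<open>d * (1 + d) + d + d = d * (3 + d)\<close> times the product of the three probabilities, and
  \<open>d \<le> T\<close>.\<close>

lemma psi_mixing_two_sided:
  assumes A: "determined_by (stake n) A"
    and B: "determined_by (\<lambda>x. stake k (sdrop (i - 1) x)) B"
    and C: "determined_by (\<lambda>x. stake m (sdrop (l - 1) x)) C"
    and gap: "n = 0 \<or> n + g < i" "i - 1 + k + g < l" "1 \<le> g" "1 \<le> i"
  shows "\<bar>prob (B \<inter> (A \<inter> C)) - prob B * prob (A \<inter> C)\<bar>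
    \<le> T * \<sigma> ^ g * (3 + T) * prob B * (prob A * prob C)"
proof -
  define d where "d = T * \<sigma> ^ g"
  have d: "0 \<le> d" "d \<le> T"
    using T \<sigma> by (auto simp: d_def power_le_one mult_left_le)
  have 1: "\<bar>prob (A \<inter> (B \<inter> C)) - prob A * prob (B \<inter> C)\<bar> \<le> d * (prob A * prob (B \<inter> C))"
    unfolding d_def
  proof (rule psi_mixing_product[OF A _ gap(1,3)])
    \<comment> \<open>A single window from position \<open>i\<close> of length
      \<open>l + m + k\<close> covers both the window of \<open>B\<close> and that of
      \<open>C\<close>.\<close>
    have s: "stake k (sdrop (i - 1) x) = stake k (sdrop (i - 1) y) \<and>
        stake m (sdrop (l - 1) x) = stake m (sdrop (l - 1) y)"
      if "stake (l + m + k) (sdrop (i - 1) x) = stake (l + m + k) (sdrop (i - 1) y)" for x y :: "'a stream"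
    proof
      show "stake k (sdrop (i - 1) x) = stake k (sdrop (i - 1) y)"
        using that by (rule stake_eq_prefix) simp
      have "stake m (sdrop (l - i) (sdrop (i - 1) x)) = stake m (sdrop (l - i) (sdrop (i - 1) y))"
        using that by (rule stake_sdrop_eq) simp
      moreover have "i - 1 + (l - i) = l - 1" using gap by simp
      ultimately show "stake m (sdrop (l - 1) x) = stake m (sdrop (l - 1) y)"
        by (simp add: add.commute)
    qed
    show "determined_by (\<lambda>x. stake (l + m + k) (sdrop (i - 1) x)) (B \<inter> C)"
      by (intro determined_by_Int determined_by_mono[OF B] determined_by_mono[OF C]) (use s in blast)+
  qed
  have 2: "\<bar>prob (B \<inter> C) - prob B * prob C\<bar> \<le> d * (prob B * prob C)"
    unfolding d_def
  proof (rule psi_mixing_product[OF _ C])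
    show "determined_by (stake (i - 1 + k)) B"
      using B by (rule determined_by_mono) (auto intro: stake_sdrop_eq)
  qed (use gap in auto)
  have 3: "\<bar>prob (A \<inter> C) - prob A * prob C\<bar> \<le> d * (prob A * prob C)"
    unfolding d_def by (rule psi_mixing_product[OF A C]) (use gap in auto)
  define a b c where abc: "a = prob A" "b = prob B" "c = prob C"
  have nn: "0 \<le> a" "0 \<le> b" "0 \<le> c" by (auto simp: abc)
  have BC: "prob (B \<inter> C) \<le> (1 + d) * (b * c)" using 2 by (simp add: abc algebra_simps)
  \<comment> \<open>The intermediate terms \<open>a * prob (B \<inter> C)\<close> and
    \<open>a * b * c\<close> are inserted.\<close>
  have "\<bar>prob (A \<inter> (B \<inter> C)) - b * prob (A \<inter> C)\<bar>
     \<le> \<bar>prob (A \<inter> (B \<inter> C)) - a * prob (B \<inter> C)\<bar> + \<bar>a * (prob (B \<inter> C) - b * c)\<bar>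
       + \<bar>b * (prob (A \<inter> C) - a * c)\<bar>"
    by (simp add: algebra_simps)
  also have "\<dots> \<le> d * (a * ((1 + d) * (b * c))) + a * (d * (b * c)) + b * (d * (a * c))"
  proof (intro add_mono)
    show "\<bar>prob (A \<inter> (B \<inter> C)) - a * prob (B \<inter> C)\<bar> \<le> d * (a * ((1 + d) * (b * c)))"
      using 1 BC nn d unfolding abc by (meson mult_left_mono order_trans)
    show "\<bar>a * (prob (B \<inter> C) - b * c)\<bar> \<le> a * (d * (b * c))"
      using 2 nn by (simp add: abs_mult abc mult_left_mono)
    show "\<bar>b * (prob (A \<inter> C) - a * c)\<bar> \<le> b * (d * (a * c))"
      using 3 nn by (simp add: abs_mult abc mult_left_mono)
  qed
  also have "\<dots> = d * (3 + d) * b * (a * c)" by (simp add: algebra_simps)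
  also have "\<dots> \<le> d * (3 + T) * b * (a * c)"
    using d nn by (intro mult_right_mono mult_left_mono) auto
  finally show ?thesis by (simp add: abc d_def Int_left_commute)
qed

lemma occ_determined: "determined_by (\<lambda>x. stake (length w) (sdrop (j - 1) x)) {x. occ j x w = c}"
  by (rule determined_byI) (simp add: occ_def)

lemma occ_event [measurable]: "{x. occ j x w = 1} \<in> events"
  using determined_by_sdrop_event[OF occ_determined] .

lemma prob_occ:
  assumes "w \<noteq> []" "1 \<le> j"
  shows "prob {x. occ j x w = 1} = word_prob \<mu> w"
proof -
  have "prob {x. occ j x w = 1} = prob {x. occ 1 x w = 1}"
    using invariant assms unfolding word_invariant_def
    by (metis One_nat_def Suc_leI length_greater_0_conv order_refl)
  also have "\<dots> = word_prob \<mu> w" by (simp add: occ_def word_prob_def)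
  finally show ?thesis .
qed

text \<open>The maximum with 1 admits the empty word, which has probability 1 and arises when a word
  is shortened in \<open>prob_overlap\<close>.\<close>

lemma prob_occ_le: "1 \<le> j \<Longrightarrow> prob {x. occ j x w = 1} \<le> max 1 K * \<rho> ^ length w"
proof (cases "w = []")
  case False
  assume "1 \<le> j"
  then have "prob {x. occ j x w = 1} \<le> K * \<rho> ^ length w" using False contraction prob_occ by simp
  also have "\<dots> \<le> max 1 K * \<rho> ^ length w" using \<rho> by (intro mult_right_mono) auto
  finally show ?thesis .
qed (simp add: le_max_iff_disj)

text \<open>Of the first occurrence only the part left of the second one, with one letter removed
  to create a gap, is kept.\<close>

lemma prob_overlap:
  assumes "1 \<le> i" "1 \<le> l" "w \<noteq> []"
  shows "prob ({x. occ i x w = 1} \<inter> {x. occ (i + l) x w = 1})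
    \<le> (1 + T) * max 1 K * \<rho> ^ (min l (length w) - 1) * word_prob \<mu> w"
proof -
  define v where "v = take (min l (length w) - 1) w"
  have lv: "length v = min l (length w) - 1" by (auto simp: v_def)
  have A: "determined_by (stake (i - 1 + length v)) {x. occ i x v = 1}"
    using occ_determined by (rule determined_by_mono) (auto intro: stake_sdrop_eq)
  have "prob ({x. occ i x w = 1} \<inter> {x. occ (i + l) x w = 1})
      \<le> prob ({x. occ i x v = 1} \<inter> {x. occ (i + l) x w = 1})"
  proof (rule finite_measure_mono)
    have "stake (length v) s = v" if "stake (length w) s = w" for s
    proof -
      have "stake (length v) s = take (length v) (stake (length w) s)"
        using lv by (simp add: take_stake min.absorb1)
      also have "\<dots> = v" using that lv by (simp add: v_def)
      finally show ?thesis .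
    qed
    then show "{x. occ i x w = 1} \<inter> {x. occ (i + l) x w = 1} \<subseteq> {x. occ i x v = 1} \<inter> {x. occ (i + l) x w = 1}"
      unfolding occ_eq_1_iff by auto
  qed (intro sets.Int occ_event)
  also have "\<dots> \<le> prob {x. occ i x v = 1} * prob {x. occ (i + l) x w = 1}
      + T * \<sigma> ^ 1 * (prob {x. occ i x v = 1} * prob {x. occ (i + l) x w = 1})"
  proof -
    have "i - 1 + length v + 1 < i + l" using assms(1,2) lv by linarith
    then show ?thesis
      using psi_mixing_product[OF A occ_determined[of w "i + l" 1] _ order_refl] by (simp add: abs_le_iff)
  qed
  also have "\<dots> = (1 + T * \<sigma>) * prob {x. occ i x v = 1} * word_prob \<mu> w"
    using prob_occ[of w "i + l"] assms by (simp add: algebra_simps)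
  also have "\<dots> \<le> (1 + T) * (max 1 K * \<rho> ^ length v) * word_prob \<mu> w"
    using T \<sigma> \<rho> assms prob_occ_le[of i v]
    by (intro mult_mono mult_nonneg_nonneg) (auto simp: word_prob_def mult_left_le)
  finally show ?thesis by (simp add: lv mult_ac)
qed

end

subsection \<open>Poisson approximation of the number of occurrences\<close>

lemma finite_periods [simp]: "finite (periods w)"
  by (rule finite_subset[of _ "{..<length w}"]) (auto simp: periods_def)

context mixing_process
begin

text \<open>The division by \<open>\<rho>\<close> pays for the letter removed in
  \<open>prob_overlap\<close>.\<close>

definition overlap_const :: real where
  "overlap_const = (1 + T) * max 1 K / \<rho>"

text \<open>The contributions come from the squared probabilities (\<open>K\<close>), the pairs of
  nearby occurrences (\<open>overlap_const\<close>) and the distant occurrences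
  (\<open>T * (3 + T)\<close>). The factor \<open>c + 1\<close> is the neighbourhood radius in units
  of the word length.\<close>

definition approx_const :: "nat \<Rightarrow> real" where
  "approx_const c = 4 * real (c + 1) * (K + overlap_const) + T * (3 + T)"

lemma overlap_const_nonneg: "0 \<le> overlap_const"
  using T \<rho> by (simp add: overlap_const_def)

lemma approx_const_pos: "0 < approx_const c"
proof -
  have "0 \<le> 4 * real (c + 1) * (K + overlap_const)" using overlap_const_nonneg K by simp
  moreover have "0 < T * (3 + T)" using T by simp
  ultimately show ?thesis unfolding approx_const_def by linarith
qed

lemma measurable_occ: "(\<lambda>x. occ j x w) \<in> measurable \<mu> (count_space UNIV)"
proof -
  have "(\<lambda>x. if x \<in> {x. occ j x w = 1} then 1 else 0 :: nat) \<in> measurable \<mu> (count_space UNIV)"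
    using occ_event[of j w] by (intro measurable_If_set) auto
  also have "(\<lambda>x. if x \<in> {x. occ j x w = 1} then 1 else 0 :: nat) = (\<lambda>x. occ j x w)"
    by (auto simp: occ_def)
  finally show ?thesis .
qed

lemma expectation_occ:
  assumes "w \<noteq> []" "1 \<le> j"
  shows "expectation (\<lambda>x. real (occ j x w)) = word_prob \<mu> w"
  using assms by (simp add: occ_eq_indicator prob_occ del: One_nat_def)

text \<open>At a distance below the word length that is not a period, two occurrences exclude each
  other by \<open>period_of_overlap\<close>; at all other distances \<open>prob_overlap\<close>
  applies.\<close>

lemma expectation_occ_occ:
  assumes "w \<noteq> []" "1 \<le> i" "1 \<le> l"
  shows "expectation (\<lambda>x. real (occ i x w) * real (occ (i + l) x w))
    \<le> overlap_const * (if l \<in> periods w \<or> length w \<le> l then \<rho> ^ min l (length w) else 0) * word_prob \<mu> w"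
proof -
  have "expectation (\<lambda>x. real (occ i x w) * real (occ (i + l) x w))
      = expectation (indicator ({x. occ i x w = 1} \<inter> {x. occ (i + l) x w = 1}))"
    by (intro Bochner_Integration.integral_cong refl) (simp only: occ_eq_indicator indicator_inter_arith)
  also have "\<dots> = prob ({x. occ i x w = 1} \<inter> {x. occ (i + l) x w = 1})"
    by simp
  also have "\<dots> \<le> overlap_const * (if l \<in> periods w \<or> length w \<le> l then \<rho> ^ min l (length w) else 0) * word_prob \<mu> w"
  proof (cases "l \<in> periods w \<or> length w \<le> l")
    case True
    \<comment> \<open>Ensures that the exponent \<open>min l (length w) - 1\<close> is not
      truncated, so that one factor \<open>\<rho>\<close> can be split off.\<close>
    have m: "min l (length w) \<noteq> 0" using assms by auto
    have "(1 + T) * max 1 K * \<rho> ^ (min l (length w) - 1) = overlap_const * \<rho> ^ min l (length w)"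
      unfolding overlap_const_def power_eq_if[of \<rho> "min l (length w)"] if_not_P[OF m]
      using \<rho> by simp
    then show ?thesis using True prob_overlap[of i l w] assms by simp
  next
    case False
    then have "{x. occ i x w = 1} \<inter> {x. occ (i + l) x w = 1} = {}"
      using period_of_overlap[of i _ w l] assms by auto
    then show ?thesis using False by simp
  qed
  finally show ?thesis .
qed

text \<open>Periods are shorter than the word and contribute their own powers of
  \<open>\<rho>\<close>. Each of the fewer than \<open>R\<close> distances that reach the word
  length contributes \<open>\<rho> ^ length w\<close>.\<close>

lemma sum_overlaps:
  assumes "w \<noteq> []" "1 \<le> i" and S: "S \<subseteq> {1..<R}"
  shows "(\<Sum>l\<in>S. overlap_const * (if l \<in> periods w \<or> length w \<le> l then \<rho> ^ min l (length w) else 0) * word_prob \<mu> w)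
    \<le> overlap_const * ((\<Sum>l\<in>periods w. \<rho> ^ l) + real R * \<rho> ^ length w) * word_prob \<mu> w"
proof -
  have fS: "finite S" using S finite_subset by blast
  have "(\<Sum>l\<in>S. if l \<in> periods w \<or> length w \<le> l then \<rho> ^ min l (length w) else 0)
     \<le> (\<Sum>l\<in>S. (if l \<in> periods w then \<rho> ^ l else 0) + \<rho> ^ length w)"
    using \<rho> by (intro sum_mono) (auto simp: periods_def min_def)
  also have "\<dots> = (\<Sum>l\<in>S \<inter> periods w. \<rho> ^ l) + real (card S) * \<rho> ^ length w"
    using fS by (simp add: sum.distrib sum.inter_restrict)
  also have "\<dots> \<le> (\<Sum>l\<in>periods w. \<rho> ^ l) + real R * \<rho> ^ length w"
  proof (intro add_mono mult_right_mono sum_mono2)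
    have "card S \<le> card {1..<R}" using S by (intro card_mono) auto
    then show "real (card S) \<le> real R" by simp
  qed (use \<rho> in auto)
  finally have "(\<Sum>l\<in>S. if l \<in> periods w \<or> length w \<le> l then \<rho> ^ min l (length w) else 0)
     \<le> (\<Sum>l\<in>periods w. \<rho> ^ l) + real R * \<rho> ^ length w" .
  then have "overlap_const * (\<Sum>l\<in>S. if l \<in> periods w \<or> length w \<le> l then \<rho> ^ min l (length w) else 0) * word_prob \<mu> w
     \<le> overlap_const * ((\<Sum>l\<in>periods w. \<rho> ^ l) + real R * \<rho> ^ length w) * word_prob \<mu> w"
    using overlap_const_nonneg by (intro mult_right_mono mult_left_mono) (auto simp: word_prob_def)
  then show ?thesis by (simp add: sum_distrib_left sum_distrib_right)
qed

text \<open>Neighbours on either side are indexed by their distance from \<open>i\<close>, which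
  gives the factor 2. For those to the left the two occurrences are swapped, so that the earlier one
  comes first.\<close>

lemma sum_neighbour_overlaps:
  assumes w: "w \<noteq> []" and i: "1 \<le> i" and N: "N \<subseteq> {j. 1 \<le> j \<and> j < i + R \<and> i < j + R}"
  shows "(\<Sum>j\<in>N - {i}. expectation (\<lambda>x. real (occ i x w) * real (occ j x w)))
    \<le> 2 * (overlap_const * ((\<Sum>l\<in>periods w. \<rho> ^ l) + real R * \<rho> ^ length w) * word_prob \<mu> w)"
proof -
  define q where "q l = overlap_const * (if l \<in> periods w \<or> length w \<le> l then \<rho> ^ min l (length w) else 0) * word_prob \<mu> w" for l
  define e where "e j = expectation (\<lambda>x. real (occ i x w) * real (occ j x w))" for j
  define Q where "Q = overlap_const * ((\<Sum>l\<in>periods w. \<rho> ^ l) + real R * \<rho> ^ length w) * word_prob \<mu> w"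
  have N': "1 \<le> j \<and> j < i + R \<and> i < j + R" if "j \<in> N" for j using N that by auto
  have fN: "finite N" by (rule finite_subset[OF N]) (rule finite_subset[of _ "{..<i + R}"], auto)
  have "(\<Sum>j\<in>{j\<in>N. i < j}. e j) \<le> (\<Sum>j\<in>{j\<in>N. i < j}. q (j - i))"
  proof (rule sum_mono)
    fix j assume "j \<in> {j\<in>N. i < j}"
    then have "1 \<le> j - i" "i + (j - i) = j" by auto
    then show "e j \<le> q (j - i)"
      unfolding e_def q_def using expectation_occ_occ[OF w i, of "j - i"] by metis
  qed
  also have "\<dots> = (\<Sum>l\<in>(\<lambda>j. j - i) ` {j\<in>N. i < j}. q l)"
    by (subst sum.reindex) (auto simp: inj_on_def)
  also have "\<dots> \<le> Q"
    unfolding q_def Q_def by (intro sum_overlaps w i) (auto dest!: N')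
  finally have 1: "(\<Sum>j\<in>{j\<in>N. i < j}. e j) \<le> Q" .
  have "(\<Sum>j\<in>{j\<in>N. j < i}. e j) \<le> (\<Sum>j\<in>{j\<in>N. j < i}. q (i - j))"
  proof (rule sum_mono)
    fix j assume "j \<in> {j\<in>N. j < i}"
    then have j: "1 \<le> j" "1 \<le> i - j" "j + (i - j) = i" using N by auto
    have "e j = expectation (\<lambda>x. real (occ j x w) * real (occ (j + (i - j)) x w))"
      unfolding e_def j(3) by (simp only: mult.commute)
    also have "\<dots> \<le> q (i - j)"
      unfolding q_def by (rule expectation_occ_occ[OF w j(1,2)])
    finally show "e j \<le> q (i - j)" .
  qed
  also have "\<dots> = (\<Sum>l\<in>(\<lambda>j. i - j) ` {j\<in>N. j < i}. q l)"
    by (subst sum.reindex) (auto simp: inj_on_def)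
  also have "\<dots> \<le> Q"
    unfolding q_def Q_def by (intro sum_overlaps w i) (auto dest!: N')
  finally have 2: "(\<Sum>j\<in>{j\<in>N. j < i}. e j) \<le> Q" .
  have N_split: "N - {i} = {j\<in>N. i < j} \<union> {j\<in>N. j < i}" by auto
  have "(\<Sum>j\<in>N - {i}. e j) = (\<Sum>j\<in>{j\<in>N. i < j}. e j) + (\<Sum>j\<in>{j\<in>N. j < i}. e j)"
    unfolding N_split by (rule sum.union_disjoint) (use fN in auto)
  then show ?thesis using 1 2 by (simp add: e_def Q_def)
qed

text \<open>Outside the neighbourhood the count splits into a past part \<open>U\<close> and a
  future part \<open>V\<close>. The radius \<open>length w + g\<close> leaves \<open>g\<close> free
  positions on each side of the occurrence at \<open>i\<close>, so two-sided mixing applies to every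
  pair of values of \<open>U\<close> and \<open>V\<close>.\<close>

lemma far_occurrences_decoupled:
  assumes w: "w \<noteq> []" and i: "1 \<le> i" and J: "finite J" "J \<subseteq> {1..}" and g: "1 \<le> g"
    and \<phi>: "\<And>j. \<bar>\<phi> j\<bar> \<le> 1"
  shows "\<bar>expectation (\<lambda>x. (real (occ i x w) - word_prob \<mu> w)
      * \<phi> (\<Sum>j\<in>J - {j\<in>J. j < i + (length w + g) \<and> i < j + (length w + g)}. occ j x w))\<bar>
    \<le> T * \<sigma> ^ g * (3 + T) * word_prob \<mu> w"
proof -
  define R where "R = length w + g"
  define P where "P = {j\<in>J. j + R \<le> i}"
  define F where "F = {j\<in>J. i + R \<le> j}"
  define U where "U x = (\<Sum>j\<in>P. occ j x w)" for x
  define V where "V x = (\<Sum>j\<in>F. occ j x w)" for x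
  define B where "B = {x. occ i x w = 1}"
  have PF: "J - {j\<in>J. j < i + R \<and> i < j + R} = P \<union> F" "P \<inter> F = {}"
    using g by (auto simp: P_def F_def R_def)
  have fin: "finite P" "finite F" using J by (auto simp: P_def F_def)
  \<comment> \<open>A bound on all positions makes the future count depend on a finite
    window.\<close>
  obtain m where m: "\<And>j. j \<in> J \<Longrightarrow> j \<le> m"
    using J(1) finite_nat_set_iff_bounded_le by auto
  have mU: "U \<in> measurable \<mu> (count_space UNIV)" and mV: "V \<in> measurable \<mu> (count_space UNIV)"
    unfolding U_def[abs_def] V_def[abs_def] by (rule measurable_sum_nat, rule measurable_occ)+
  have bound: "(\<Sum>j\<in>A. occ j x w) \<le> card J" if "A \<subseteq> J" for A and x :: "'a stream"
  proof -
    have "(\<Sum>j\<in>A. occ j x w) \<le> (\<Sum>j\<in>A. 1)" by (intro sum_mono occ_le_1)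
    also have "\<dots> \<le> card J" using that J by (simp add: card_mono)
    finally show ?thesis .
  qed
  \<comment> \<open>If the subtraction is truncated to 0, then \<open>P\<close> is empty and
    \<open>U\<close> is constant; this is the case \<open>n = 0\<close> of the mixing
    estimates.\<close>
  have past: "determined_by (stake (i - 1 - g)) {x. U x = u}" for u
  proof (rule determined_byI)
    fix x y :: "'a stream" assume xy: "stake (i - 1 - g) x = stake (i - 1 - g) y" "x \<in> {x. U x = u}"
    have "occ j x w = occ j y w" if "j \<in> P" for j
      using that J xy(1) by (intro occ_cong[of 1 j "i - 1 - g"]) (auto simp: P_def R_def)
    then have "U x = U y" by (simp add: U_def)
    then show "y \<in> {x. U x = u}" using xy by simp
  qed
  have future: "determined_by (\<lambda>x. stake (m + length w) (sdrop (i + R - 1) x)) {x. V x = v}" for v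
  proof (rule determined_byI)
    fix x y :: "'a stream"
    assume xy: "stake (m + length w) (sdrop (i + R - 1) x) = stake (m + length w) (sdrop (i + R - 1) y)"
      "x \<in> {x. V x = v}"
    have "occ j x w = occ j y w" if "j \<in> F" for j
      using that J xy(1) i m by (intro occ_cong[of "i + R" j "m + length w"]) (auto simp: F_def intro: trans_le_add1)
    then have "V x = V y" by (simp add: V_def)
    then show "y \<in> {x. V x = v}" using xy by simp
  qed
  have pB: "prob B = word_prob \<mu> w" unfolding B_def using w i by (rule prob_occ)
  have "\<bar>expectation (\<lambda>x. (indicator B x - prob B) * \<phi> (U x + V x))\<bar>
      \<le> T * \<sigma> ^ g * (3 + T) * prob B"
  proof (rule almost_independent_expectation[OF mU _ mV])
    show "U x \<le> card J" "V x \<le> card J" for x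
      unfolding U_def V_def by (rule bound, auto simp: P_def F_def)+
    show "B \<in> events" unfolding B_def by (rule occ_event)
    show "\<bar>prob (B \<inter> ({x \<in> space \<mu>. U x = u} \<inter> {x \<in> space \<mu>. V x = v}))
        - prob B * prob ({x \<in> space \<mu>. U x = u} \<inter> {x \<in> space \<mu>. V x = v})\<bar>
        \<le> T * \<sigma> ^ g * (3 + T) * prob B * (prob {x \<in> space \<mu>. U x = u} * prob {x \<in> space \<mu>. V x = v})"
      for u v
    proof -
      have "\<bar>prob (B \<inter> ({x. U x = u} \<inter> {x. V x = v})) - prob B * prob ({x. U x = u} \<inter> {x. V x = v})\<bar>
        \<le> T * \<sigma> ^ g * (3 + T) * prob B * (prob {x. U x = u} * prob {x. V x = v})"
        unfolding B_def
        by (rule psi_mixing_two_sided[OF past occ_determined future])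
           (use g i in \<open>auto simp: R_def\<close>)
      then show ?thesis by simp
    qed
  qed (rule \<phi>)
  also have "(\<lambda>x. (indicator B x - prob B) * \<phi> (U x + V x))
     = (\<lambda>x. (real (occ i x w) - word_prob \<mu> w) * \<phi> (\<Sum>j\<in>P \<union> F. occ j x w))"
    unfolding pB U_def V_def sum.union_disjoint[OF fin PF(2)] by (simp only: occ_eq_indicator B_def)
  finally show ?thesis by (simp only: PF(1)[symmetric] pB R_def)
qed

text \<open>\<open>chen_stein\<close> is applied with the positions at distance less than
  \<open>R = (c + 1) * k\<close> as neighbourhoods. Each position then costs at most
  \<open>p * approx_const c * E\<close>, and summing \<open>p\<close> over \<open>J\<close> gives
  \<open>lam\<close>.\<close>

lemma poisson_approximation:
  assumes w: "w \<noteq> []" "0 < word_prob \<mu> w" and J: "finite J" "J \<subseteq> {1..}" "J \<noteq> {}"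
    and c: "1 \<le> c" "\<sigma> ^ c \<le> \<rho>" and h: "\<And>j. \<bar>h j\<bar> \<le> 1"
  defines "lam \<equiv> real (card J) * word_prob \<mu> w"
  shows "\<bar>expectation (\<lambda>x. h (\<Sum>j\<in>J. occ j x w)) - poisson_avg lam h\<bar>
    \<le> 2 * exp lam * (lam * approx_const c * (real (length w) * \<rho> ^ length w + (\<Sum>l\<in>periods w. \<rho> ^ l)))"
proof -
  define k where "k = length w"
  define p where "p = word_prob \<mu> w"
  define g where "g = c * k"
  define R where "R = k + g"
  define N where "N i = {j\<in>J. j < i + (length w + g) \<and> i < j + (length w + g)}" for i
  define Per where "Per = (\<Sum>l\<in>periods w. \<rho> ^ l)"
  define E where "E = real k * \<rho> ^ k + Per"
  have k: "1 \<le> k" using w by (cases w) (auto simp: k_def)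
  have g: "1 \<le> g" using k c by (simp add: g_def)
  have Per: "0 \<le> Per" unfolding Per_def using \<rho> by (intro sum_nonneg) auto
  have p: "0 < p" "p \<le> K * \<rho> ^ k" using w contraction by (auto simp: p_def k_def)
  have lam: "(\<Sum>i\<in>J. p) = lam" by (simp add: lam_def p_def)
  have posc: "0 < (\<Sum>i\<in>J. p)" using p J by (intro sum_pos) auto
  \<comment> \<open>This fixes the choice of \<open>g\<close>: a gap of \<open>c * k\<close>
    positions makes the mixing error as small as the contraction bound for a word of length
    \<open>k\<close>.\<close>
  have "\<sigma> ^ g = (\<sigma> ^ c) ^ k" by (simp add: g_def power_mult)
  also have "\<dots> \<le> \<rho> ^ k" using c \<sigma> by (intro power_mono) auto
  finally have sg: "\<sigma> ^ g \<le> \<rho> ^ k" .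
  have "\<bar>expectation (\<lambda>x. h (\<Sum>j\<in>J. occ j x w)) - poisson_avg (\<Sum>i\<in>J. p) h\<bar>
    \<le> 2 * exp (\<Sum>i\<in>J. p) * (\<Sum>i\<in>J. 2 * p * (\<Sum>j\<in>N i. p)
        + 2 * (\<Sum>j\<in>N i - {i}. expectation (\<lambda>x. real (occ i x w) * real (occ j x w)))
        + T * \<sigma> ^ g * (3 + T) * p)"
  proof (rule chen_stein[OF J(1)])
    show "\<bar>expectation (\<lambda>x. (real (occ i x w) - p) * \<phi> (\<Sum>j\<in>J - N i. occ j x w))\<bar>
      \<le> T * \<sigma> ^ g * (3 + T) * p" if "i \<in> J" "\<And>j. \<bar>\<phi> j\<bar> \<le> 1" for i \<phi>
      unfolding p_def N_def using that J by (intro far_occurrences_decoupled w g) auto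
    show "i \<in> N i \<and> N i \<subseteq> J" if "i \<in> J" for i using that g by (auto simp: N_def)
    show "expectation (\<lambda>x. real (occ i x w)) = p" if "i \<in> J" for i
      unfolding p_def using that J by (intro expectation_occ w) auto
  qed (use posc h measurable_occ occ_le_1 in auto)
  also have "\<dots> \<le> 2 * exp (\<Sum>i\<in>J. p) * (\<Sum>i\<in>J. p * (approx_const c * E))"
  proof (intro mult_left_mono sum_mono)
    fix i assume i: "i \<in> J"
    have Rk: "real R = real (c + 1) * real k" by (simp add: R_def g_def algebra_simps)
    \<comment> \<open>Truncation of \<open>i - R\<close> at 0 only shortens the interval, so its
      length is still at most \<open>2 * R\<close>.\<close>
    have "card (N i) \<le> card {i - R..<i + R}"
      by (intro card_mono) (auto simp: N_def R_def k_def)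
    then have cN: "real (card (N i)) \<le> 2 * real R" by (simp add: of_nat_diff)
    have "2 * p * (\<Sum>j\<in>N i. p) = p * (2 * (real (card (N i)) * p))" by simp
    also have "\<dots> \<le> p * (2 * (2 * real R * (K * \<rho> ^ k)))"
      using p cN by (intro mult_left_mono mult_mono) auto
    also have "\<dots> = p * (4 * real (c + 1) * K * (real k * \<rho> ^ k))" by (simp add: Rk)
    finally have b1: "2 * p * (\<Sum>j\<in>N i. p) \<le> p * (4 * real (c + 1) * K * (real k * \<rho> ^ k))" .
    have "(\<Sum>j\<in>N i - {i}. expectation (\<lambda>x. real (occ i x w) * real (occ j x w)))
      \<le> 2 * (overlap_const * ((\<Sum>l\<in>periods w. \<rho> ^ l) + real R * \<rho> ^ length w) * word_prob \<mu> w)"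
      using J i by (intro sum_neighbour_overlaps w) (auto simp: N_def R_def k_def)
    also have "\<dots> \<le> 2 * (overlap_const * (real (c + 1) * E) * p)"
    proof -
      have "Per + real R * \<rho> ^ k \<le> real (c + 1) * E"
        using Per mult_right_mono[OF Per, of "real c"] by (simp add: Rk E_def algebra_simps)
      then show ?thesis unfolding Per_def[symmetric] k_def[symmetric] p_def[symmetric]
        using overlap_const_nonneg p by (intro mult_left_mono mult_right_mono) auto
    qed
    finally have "(\<Sum>j\<in>N i - {i}. expectation (\<lambda>x. real (occ i x w) * real (occ j x w)))
      \<le> 2 * (overlap_const * (real (c + 1) * E) * p)" .
    from mult_left_mono[OF this, of 2] have b2: "2 * (\<Sum>j\<in>N i - {i}. expectation (\<lambda>x. real (occ i x w) * real (occ j x w)))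
      \<le> p * (4 * real (c + 1) * overlap_const * E)"
      by (simp add: algebra_simps)
    have kE: "real k * \<rho> ^ k \<le> E" using Per by (simp add: E_def)
    \<comment> \<open>Since \<open>k \<ge> 1\<close>, the mixing error is absorbed into the first
      part of \<open>E\<close>.\<close>
    have "\<rho> ^ k \<le> real k * \<rho> ^ k" using k \<rho> by simp
    then have "\<sigma> ^ g \<le> E" using kE sg by linarith
    then have b3: "T * \<sigma> ^ g * (3 + T) * p \<le> T * E * (3 + T) * p"
      using T p by (intro mult_right_mono mult_left_mono) auto
    have "p * (4 * real (c + 1) * K * (real k * \<rho> ^ k)) \<le> p * (4 * real (c + 1) * K * E)"
      using kE p K by (intro mult_left_mono) auto
    then have "2 * p * (\<Sum>j\<in>N i. p)
        + 2 * (\<Sum>j\<in>N i - {i}. expectation (\<lambda>x. real (occ i x w) * real (occ j x w)))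
        + T * \<sigma> ^ g * (3 + T) * p
      \<le> p * (4 * real (c + 1) * K * E) + p * (4 * real (c + 1) * overlap_const * E) + T * E * (3 + T) * p"
      using b1 b2 b3 by linarith
    also have "\<dots> = p * (approx_const c * E)" by (simp add: approx_const_def algebra_simps)
    finally show "2 * p * (\<Sum>j\<in>N i. p)
        + 2 * (\<Sum>j\<in>N i - {i}. expectation (\<lambda>x. real (occ i x w) * real (occ j x w)))
        + T * \<sigma> ^ g * (3 + T) * p \<le> p * (approx_const c * E)" .
  qed simp
  also have "(\<Sum>i\<in>J. p * (approx_const c * E)) = lam * approx_const c * E"
    by (simp add: lam_def p_def)
  finally show ?thesis unfolding lam by (simp only: E_def Per_def k_def)
qed

end

section \<open>From the mean number of occurrences to the measure of \<open>S\<close>\<close>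

theorem lemma4:
  fixes \<mu> :: "'a::countable stream measure" and \<rho> :: real
  assumes "\<exists>a b :: 'a. a \<noteq> b"
    and "prob_space \<mu>"
    and "sets \<mu> = sets (stream_space (count_space UNIV))"
    and "word_invariant \<mu>"
    and "exp_psi_mixing \<mu>"
    and "has_contraction_ratio \<mu> \<rho>"
  shows "\<exists>C :: real \<Rightarrow> nat \<Rightarrow> real. (\<forall>a n. 0 < C a n) \<and>
    (\<forall>n S. S \<subseteq> {0..} \<and> union_of_bounded_intervals n S \<longrightarrow>
      (\<exists>k0\<ge>1. \<forall>k\<ge>k0. \<forall>w. length w = k \<and> 0 < word_prob \<mu> w \<longrightarrow>
        (\<forall>h :: nat \<Rightarrow> real. (\<forall>j. \<bar>h j\<bar> \<le> 1) \<longrightarrow>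
          \<bar>(\<integral>x. h (scaled_count \<mu> w S x) \<partial>\<mu>) - poisson_avg (measure lborel S) h\<bar>
            \<le> C (measure lborel S) n * (real k * \<rho> ^ k + (\<Sum>l\<in>periods w. \<rho> ^ l)))))"
proof -
  obtain \<sigma> T where \<sigma>T: "0 < \<sigma>" "\<sigma> < 1" "0 < T"
    and mix: "\<And>k l A B. \<lbrakk>1 \<le> k; k < l; A \<in> block_algebra 1 k; B \<in> tail_algebra l;
        measure \<mu> A \<noteq> 0; measure \<mu> B \<noteq> 0\<rbrakk>
      \<Longrightarrow> \<bar>measure \<mu> (A \<inter> B) / (measure \<mu> A * measure \<mu> B) - 1\<bar> \<le> T * \<sigma> ^ (l - k)"
    using assms(5) unfolding exp_psi_mixing_def by metis
  obtain K where "0 < K" and K_contr: "\<And>w. 1 \<le> length w \<Longrightarrow> word_prob \<mu> w \<le> K * \<rho> ^ length w"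
    and \<rho>: "0 < \<rho>" "\<rho> < 1"
    using assms(6) unfolding has_contraction_ratio_def by metis
  have "mixing_process \<mu> \<sigma> T \<rho> K"
    unfolding mixing_process_def mixing_process_axioms_def
    using assms(2-4) \<sigma>T mix \<open>0 < K\<close> K_contr \<rho> by (auto simp: Suc_le_eq)
  then interpret mixing_process \<mu> \<sigma> T \<rho> K .
  obtain c0 where "\<sigma> ^ c0 < \<rho>" using real_arch_pow_inv[OF \<rho>(1) \<sigma>T(2)] by blast
  \<comment> \<open>The exponent is positive because \<open>\<sigma> ^ 0 = 1\<close> exceeds
    \<open>\<rho>\<close>.\<close>
  moreover have "c0 \<noteq> 0" using calculation \<rho> by (cases c0) auto
  ultimately obtain c where c: "1 \<le> c" "\<sigma> ^ c \<le> \<rho>" by (metis less_imp_le less_one not_le)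
  \<comment> \<open>The mean \<open>lam\<close> is at most \<open>a + 2 * n\<close>, which gives the
    first summand. The term \<open>4 * n * K\<close> is the cost of replacing \<open>lam\<close> by
    \<open>a\<close>. The absolute value and the final 1 keep \<open>C\<close> positive for all
    arguments.\<close>
  define C where "C a n = 2 * exp (\<bar>a\<bar> + 2 * real n) * ((\<bar>a\<bar> + 2 * real n) * approx_const c)
      + (4 * real n * K + 1)" for a n
  have C: "0 < C a n" for a n
    using approx_const_pos[of c] K by (auto simp: C_def intro!: add_nonneg_pos mult_nonneg_nonneg)
  have main: "\<bar>expectation (\<lambda>x. h (scaled_count \<mu> w S x)) - poisson_avg (measure lborel S) h\<bar>
            \<le> C (measure lborel S) n * (real (length w) * \<rho> ^ length w + (\<Sum>l\<in>periods w. \<rho> ^ l))"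
    if S: "S \<subseteq> {0..}" "union_of_bounded_intervals n S" and w: "1 \<le> length w" "0 < word_prob \<mu> w"
      and h: "\<And>j. \<bar>h j\<bar> \<le> 1" for n S w and h :: "nat \<Rightarrow> real"
  proof -
    define J where "J = {j. 1 \<le> j \<and> real j * word_prob \<mu> w \<in> S}"
    define lam where "lam = real (card J) * word_prob \<mu> w"
    define a where "a = measure lborel S"
    define Per where "Per = (\<Sum>l\<in>periods w. \<rho> ^ l)"
    define E where "E = real (length w) * \<rho> ^ length w + Per"
    have w': "w \<noteq> []" using w by auto
    have fJ: "finite J" unfolding J_def
      using S w by (intro finite_lattice_points union_of_bounded_intervals_bounded)
    have count: "scaled_count \<mu> w S x = (\<Sum>j\<in>J. occ j x w)" for x
      by (simp add: scaled_count_def J_def)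
    have Per: "0 \<le> Per" unfolding Per_def using \<rho> by (intro sum_nonneg) auto
    have "\<rho> ^ length w \<le> real (length w) * \<rho> ^ length w" using w \<rho> by simp
    then have rE: "\<rho> ^ length w \<le> E" using Per by (simp add: E_def)
    have E: "0 \<le> E" using rE \<rho> by (meson order_trans zero_le_power less_imp_le)
    have a0: "0 \<le> a" by (simp add: a_def)
    have p1: "word_prob \<mu> w \<le> 1" by (simp add: word_prob_def)
    have la: "\<bar>lam - a\<bar> \<le> 2 * real n * word_prob \<mu> w"
      unfolding lam_def a_def J_def using S w by (intro lattice_points_measure)
    have "2 * real n * word_prob \<mu> w \<le> 2 * real n" using p1 by (simp add: mult_left_le)
    then have lam_le: "lam \<le> \<bar>a\<bar> + 2 * real n" using la by linarith
    have lam0: "0 \<le> lam" using w by (simp add: lam_def)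
    have "2 * real n * word_prob \<mu> w \<le> 2 * real n * (K * E)"
    proof (intro mult_left_mono)
      have "word_prob \<mu> w \<le> K * \<rho> ^ length w" using w(1) by (rule K_contr)
      also have "\<dots> \<le> K * E" using rE K by (intro mult_left_mono) auto
      finally show "word_prob \<mu> w \<le> K * E" .
    qed simp
    then have la': "2 * \<bar>lam - a\<bar> \<le> 4 * real n * K * E" using la by (simp add: mult_ac)
    have 1: "\<bar>expectation (\<lambda>x. h (\<Sum>j\<in>J. occ j x w)) - poisson_avg lam h\<bar>
        \<le> 2 * exp lam * (lam * approx_const c * E)"
    \<comment> \<open>Without positions the count and \<open>lam\<close> are both 0, and the two
      averages equal \<open>h 0\<close>.\<close>
    proof (cases "J = {}")
      case True
      then show ?thesis using prob_space by (simp add: lam_def poisson_avg_0)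
    next
      case False
      then show ?thesis unfolding E_def Per_def lam_def
        using w w' fJ c h by (intro poisson_approximation) (auto simp: J_def)
    qed
    have 2: "\<bar>poisson_avg lam h - poisson_avg a h\<bar> \<le> 2 * \<bar>lam - a\<bar>"
      using lam0 a0 h by (rule poisson_avg_lipschitz)
    have "2 * exp lam * (lam * approx_const c * E)
        \<le> 2 * exp (\<bar>a\<bar> + 2 * real n) * ((\<bar>a\<bar> + 2 * real n) * approx_const c * E)"
      using lam_le lam0 E approx_const_pos[of c] by (intro mult_mono) auto
    then have "\<bar>expectation (\<lambda>x. h (\<Sum>j\<in>J. occ j x w)) - poisson_avg a h\<bar>
      \<le> 2 * exp (\<bar>a\<bar> + 2 * real n) * ((\<bar>a\<bar> + 2 * real n) * approx_const c * E) + 4 * real n * K * E"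
      using 1 2 la' by linarith
    also have "\<dots> \<le> C a n * E" using E by (simp add: C_def algebra_simps)
    finally show ?thesis by (simp only: count a_def E_def Per_def)
  qed
  show ?thesis
  proof (intro exI[of _ C] conjI allI impI)
    show "0 < C a n" for a n by (rule C)
    fix n S assume S: "S \<subseteq> {0..} \<and> union_of_bounded_intervals n S"
    show "\<exists>k0\<ge>1. \<forall>k\<ge>k0. \<forall>w. length w = k \<and> 0 < word_prob \<mu> w \<longrightarrow>
        (\<forall>h :: nat \<Rightarrow> real. (\<forall>j. \<bar>h j\<bar> \<le> 1) \<longrightarrow>
          \<bar>(\<integral>x. h (scaled_count \<mu> w S x) \<partial>\<mu>) - poisson_avg (measure lborel S) h\<bar>
            \<le> C (measure lborel S) n * (real k * \<rho> ^ k + (\<Sum>l\<in>periods w. \<rho> ^ l)))"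
    \<comment> \<open>The estimate \<open>main\<close> covers every nonempty word, so
      \<open>k0 = 1\<close> is a valid threshold.\<close>
    proof (intro exI[of _ 1] conjI allI impI)
      fix k w and h :: "nat \<Rightarrow> real"
      assume "1 \<le> k" "length w = k \<and> 0 < word_prob \<mu> w" "\<forall>j. \<bar>h j\<bar> \<le> 1"
      then show "\<bar>(\<integral>x. h (scaled_count \<mu> w S x) \<partial>\<mu>) - poisson_avg (measure lborel S) h\<bar>
            \<le> C (measure lborel S) n * (real k * \<rho> ^ k + (\<Sum>l\<in>periods w. \<rho> ^ l))"
        using main[of S n w h] S by simp
    qed simp
  qed
qed

end
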